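(* If the Lenstra–Pomerance–Wagstaff Conjecture holds, then for each $\epsilon>0$ the set of Mersenne primes (and hence the set of primes) has an $n^{1+\epsilon}$-nongappy, P-printable subset.
   Context: A Mersenne prime is a prime of the form $2^k-1$. Natural numbers are identified with their binary representations; $|m|$ is the binary length of $m$. Let $\mu(n)$ be the number of Mersenne primes of binary length at most $n$. The Lenstra–Pomerance–Wagstaff Conjecture asserts that there are infinitely many Mersenne primes and that $\lim_{n\to\infty}\mu(n)/(e^\gamma\log_2 n)=1$, where $\gamma$ is the Euler–Mascheroni constant. For $F:\mathbb{R}^+\to\mathbb{R}^+$, $S\subseteq\mathbb{N}^+$ is $F$-nongappy if $S\neq\emptyset$ and for every $m\in S$ there is $m'\in S$ with $m'>m$ and $|m'|\le F(|m|)$; "$n^{1+\epsilon}$-nongappy" means $F$-nongappy with $F(t)=t^{1+\epsilon}$. A set is P-printable if some deterministic polynomial-time Turing machine on input $1^n$ prints exactly its elements of length at most $n$. *)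

theory Defs
  imports "HOL-Analysis.Analysis" "HOL-Library.Log_Nat" "HOL-Computational_Algebra.Computational_Algebra"
begin

section \<open>Binary representations\<close>

text \<open>The binary representation has its most significant bit first and no leading zeros (so
  \<open>0\<close> is represented by the empty word).\<close>

abbreviation bin_length :: "nat \<Rightarrow> nat" where
  "bin_length m \<equiv> floorlog 2 m"

definition binary :: "nat \<Rightarrow> bool list" where
  "binary m = rev (map (bit m) [0..<bin_length m])"

lemma length_binary [simp]: "length (binary m) = bin_length m"
  by (simp add: binary_def)

lemma horner_sum_binary: "horner_sum of_bool 2 (rev (binary m)) = m"
proof -
  have "m < 2 ^ bin_length m"
    by (rule floorlog_leD[of 2 m "bin_length m"]) auto
  then show ?thesis
    by (simp add: binary_def horner_sum_bit_eq_take_bit take_bit_nat_eq_self_iff)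
qed


section \<open>Mersenne primes\<close>

definition mersenne_prime :: "nat \<Rightarrow> bool" where
  "mersenne_prime p \<longleftrightarrow> prime p \<and> (\<exists>k::nat. p = 2 ^ k - 1)"

definition mersenne_count :: "nat \<Rightarrow> nat" where
  "mersenne_count n = card {p. mersenne_prime p \<and> bin_length p \<le> n}"

lemma finite_bin_length_le: "finite {p. P p \<and> bin_length p \<le> n}"
  by (rule finite_subset[of _ "{..<2 ^ n}"]) (auto dest: floorlog_leD)

definition Lenstra_Pomerance_Wagstaff :: bool where
  "Lenstra_Pomerance_Wagstaff \<longleftrightarrow>
     infinite {p. mersenne_prime p} \<and>
     (\<lambda>n. real (mersenne_count n) / (exp euler_mascheroni * log 2 (real n))) \<longlonglongrightarrow> 1"

definition nongappy :: "(real \<Rightarrow> real) \<Rightarrow> nat set \<Rightarrow> bool" where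
  "nongappy F S \<longleftrightarrow>
     S \<subseteq> {0<..} \<and> S \<noteq> {} \<and>
     (\<forall>m\<in>S. \<exists>m'\<in>S. m' > m \<and> real (bin_length m') \<le> F (real (bin_length m)))"


section \<open>Deterministic multitape Turing machines\<close>

text \<open>States are the numbers below \<open>states\<close>, with \<open>0\<close> the start state, and tape symbols are the
  numbers below \<open>symbols\<close>. The tapes are infinite in both directions. Given a state and the list of
  scanned symbols (one per tape), \<open>trans\<close> yields the next state and, for every tape, the symbol to
  write and the head movement to perform afterwards. The input is on the first tape, the output on
  the last one.\<close>

datatype move = Left | Stay | Right

record turing_machine =
  tapes :: nat
  symbols :: nat
  states :: nat
  halt_state :: nat
  trans :: "nat \<Rightarrow> nat list \<Rightarrow> nat \<times> (nat \<times> move) list"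

text \<open>The four symbols that every machine has.\<close>

definition blank :: nat where "blank = 0"
definition bit_symbol :: "bool \<Rightarrow> nat" where "bit_symbol b = (if b then 2 else 1)"
definition separator :: nat where "separator = 3"

definition wf_turing_machine :: "turing_machine \<Rightarrow> bool" where
  "wf_turing_machine M \<longleftrightarrow>
     tapes M \<ge> 1 \<and> symbols M \<ge> 4 \<and> 0 < states M \<and> halt_state M < states M \<and>
     (\<forall>q < states M. \<forall>ss. length ss = tapes M \<and> set ss \<subseteq> {..<symbols M} \<longrightarrow>
        (case trans M q ss of (q', as) \<Rightarrow>
           q' < states M \<and> length as = tapes M \<and> fst ` set as \<subseteq> {..<symbols M}))"

text \<open>A tape consists of its contents and the position of the head.\<close>

type_synonym tape = "(int \<Rightarrow> nat) \<times> int"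
type_synonym config = "nat \<times> tape list"

fun scanned :: "tape \<Rightarrow> nat" where
  "scanned (c, h) = c h"

fun act :: "nat \<times> move \<Rightarrow> tape \<Rightarrow> tape" where
  "act (s, d) (c, h) = (c(h := s), case d of Left \<Rightarrow> h - 1 | Stay \<Rightarrow> h | Right \<Rightarrow> h + 1)"

fun step :: "turing_machine \<Rightarrow> config \<Rightarrow> config" where
  "step M (q, ts) =
     (if q = halt_state M then (q, ts)
      else case trans M q (map scanned ts) of (q', as) \<Rightarrow> (q', map2 act as ts))"

definition written :: "nat list \<Rightarrow> int \<Rightarrow> nat" where
  "written w i = (if 0 \<le> i \<and> i < int (length w) then w ! nat i else blank)"

definition initial_config :: "turing_machine \<Rightarrow> bool list \<Rightarrow> config" where
  "initial_config M x =
     (0, (written (map bit_symbol x), 0) # replicate (tapes M - 1) (written [], 0))"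

definition run :: "turing_machine \<Rightarrow> bool list \<Rightarrow> nat \<Rightarrow> config" where
  "run M x t = (step M ^^ t) (initial_config M x)"

definition halted :: "turing_machine \<Rightarrow> config \<Rightarrow> bool" where
  "halted M c \<longleftrightarrow> fst c = halt_state M"

definition polynomial_time :: "turing_machine \<Rightarrow> bool" where
  "polynomial_time M \<longleftrightarrow> (\<exists>p :: nat poly. \<forall>x. halted M (run M x (poly p (length x))))"

definition prints :: "turing_machine \<Rightarrow> bool list \<Rightarrow> nat list \<Rightarrow> bool" where
  "prints M x w \<longleftrightarrow> (\<exists>t. halted M (run M x t) \<and> fst (last (snd (run M x t))) = written w)"


section \<open>P-printable sets\<close>

text \<open>A list of numbers is printed as the sequence of their binary representations, each followed by
  a separator.\<close>

definition list_output :: "nat list \<Rightarrow> nat list" where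
  "list_output ms = concat (map (\<lambda>m. map bit_symbol (binary m) @ [separator]) ms)"

text \<open>The elements may be printed in any order, but without repetition.\<close>

definition P_printable :: "nat set \<Rightarrow> bool" where
  "P_printable S \<longleftrightarrow>
     (\<exists>M. wf_turing_machine M \<and> polynomial_time M \<and>
        (\<forall>n. \<exists>ms. distinct ms \<and> set ms = {m \<in> S. bin_length m \<le> n} \<and>
           prints M (replicate n True) (list_output ms)))"

end

theory Submission
  imports Defs "HOL-Number_Theory.Number_Theory" "HOL-Real_Asymp.Real_Asymp"
begin

text \<open>If \<open>\<mu>(n) / (e\<^sup>\<gamma> log\<^sub>2 n)\<close> tends to 1, then \<open>\<mu>(n\<^bsup>1+\<epsilon>\<^esup>) / (e\<^sup>\<gamma> log\<^sub>2 n)\<close> tends to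
  \<open>1 + \<epsilon>\<close>, so for all large \<open>n\<close> some Mersenne prime has length in \<open>(n, n\<^bsup>1+\<epsilon>\<^esup>]\<close>: the Mersenne primes
  longer than a suitable \<open>N\<close> form a nongappy set. They are P-printable because on input \<open>1\<^sup>n\<close> one can
  run the Lucas--Lehmer test for every exponent \<open>k\<close> with \<open>N < k \<le> n\<close>. Squaring modulo \<open>2\<^sup>k - 1\<close> takes
  \<open>k\<close> additions of rotated copies of the operand, with end-around carry.\<close>

section \<open>The Lucas--Lehmer test\<close>

text \<open>The conjecture controls gaps only beyond a threshold that depends on \<epsilon>, so the
  threshold is built into the machine as a constant. Printability is unconditional for every
  threshold \<open>N \<ge> 2\<close>; the conjecture serves only to choose \<open>N\<close>. The
  form of the modulus is what makes the test programmable by single passes over a tape: reduction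
  becomes end-around carry and doubling becomes rotation, so neither division nor comparison occurs.
  Two obstacles remain. Feeding a carry back at once would need a further pass, so it stays pending
  and is settled at the end of each squaring. And the residue 0 has two words, all zeros and all
  ones; keeping the represented number positive excludes the former, so that primality is decided by
  looking for a zero bit. The test itself is justified in the ring of numbers a + b sqrt 3, where
  the recurrence becomes repeated squaring of a unit.\<close>

datatype zroot3 = ZRoot3 (rational_part: int) (root_part: int)

instantiation zroot3 :: comm_ring_1
begin
definition "0 = ZRoot3 0 0"
definition "1 = ZRoot3 1 0"
definition "x + y = ZRoot3 (rational_part x + rational_part y) (root_part x + root_part y)"
definition "x - y = ZRoot3 (rational_part x - rational_part y) (root_part x - root_part y)"
definition "- x = ZRoot3 (- rational_part x) (- root_part x)"
definition "x * y = ZRoot3 (rational_part x * rational_part y + 3 * (root_part x * root_part y))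
   (rational_part x * root_part y + root_part x * rational_part y)"
instance
  by standard
    (auto simp: zero_zroot3_def one_zroot3_def plus_zroot3_def minus_zroot3_def uminus_zroot3_def
      times_zroot3_def algebra_simps)
end

lemmas zroot3_defs = zero_zroot3_def one_zroot3_def plus_zroot3_def minus_zroot3_def
  uminus_zroot3_def times_zroot3_def

lemma of_int_zroot3: "(of_int a :: zroot3) = ZRoot3 a 0"
proof -
  have nat: "(of_nat n :: zroot3) = ZRoot3 (int n) 0" for n
    by (induction n) (auto simp: zroot3_defs)
  show ?thesis
    by (cases a) (auto simp: nat, auto simp: zroot3_defs)
qed

lemma numeral_zroot3: "(numeral n :: zroot3) = ZRoot3 (numeral n) 0"
  by (metis of_int_numeral of_int_zroot3)

text \<open>Since 1 and sqrt 3 form an integral basis, congruences modulo an integer are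
  componentwise. This moves divisibility between the integers and the ring, and bounds the number of
  residue classes.\<close>

lemma of_int_dvd_zroot3_iff:
  "(of_int m :: zroot3) dvd x \<longleftrightarrow> m dvd rational_part x \<and> m dvd root_part x"
proof
  assume "(of_int m :: zroot3) dvd x"
  then show "m dvd rational_part x \<and> m dvd root_part x"
    by (auto simp: of_int_zroot3 times_zroot3_def elim!: dvdE)
next
  assume "m dvd rational_part x \<and> m dvd root_part x"
  then obtain a b where "rational_part x = m * a" "root_part x = m * b"
    by (auto elim!: dvdE)
  then have "x = of_int m * ZRoot3 a b"
    by (cases x) (simp add: of_int_zroot3 times_zroot3_def)
  then show "(of_int m :: zroot3) dvd x" by simp
qed

lemma dvd_power_diff:
  fixes x y m :: "'a :: comm_ring_1"
  assumes "m dvd x - y"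
  shows "m dvd x ^ n - y ^ n"
proof (induction n)
  case (Suc n)
  have "x ^ Suc n - y ^ Suc n = x * (x ^ n - y ^ n) + (x - y) * y ^ n"
    by (simp add: algebra_simps)
  then show ?case using Suc assms by simp
qed simp

text \<open>Additivity of the Frobenius map: the inner binomial coefficients vanish modulo
  \<open>p\<close>. It is applied to 1 + sqrt 3.\<close>

lemma prime_dvd_add_power_diff:
  fixes x y :: "'a :: comm_ring_1"
  assumes "prime p"
  shows "of_nat p dvd (x + y) ^ p - (x ^ p + y ^ p)"
proof -
  obtain q where p: "p = Suc q" using assms prime_gt_0_nat by (metis gr0_implies_Suc)
  have "(x + y) ^ p = (\<Sum>k\<le>p. of_nat (p choose k) * x ^ k * y ^ (p - k))"
    by (rule binomial_ring)
  also have "\<dots> = x ^ p + (\<Sum>k\<le>q. of_nat (p choose k) * x ^ k * y ^ (p - k))"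
    by (simp add: p)
  also have "(\<Sum>k\<le>q. of_nat (p choose k) * x ^ k * y ^ (p - k))
      = y ^ p + (\<Sum>k\<in>{..q} - {0}. of_nat (p choose k) * x ^ k * y ^ (p - k))"
    by (subst sum.remove[of _ 0]) auto
  finally have "(x + y) ^ p - (x ^ p + y ^ p) =
      (\<Sum>k\<in>{..q} - {0}. of_nat (p choose k) * x ^ k * y ^ (p - k))"
    by simp
  moreover have "of_nat p dvd (of_nat (p choose k) * x ^ k * y ^ (p - k))" if "k \<in> {..q} - {0}" for k
  proof -
    have "p dvd (p choose k)" using that assms p by (intro dvd_choose_prime) auto
    then show ?thesis by (auto elim!: dvdE simp: mult.assoc)
  qed
  ultimately show ?thesis by (metis (no_types, lifting) dvd_sum)
qed

section \<open>Lucas--Lehmer numbers as traces of powers of 2 + sqrt 3\<close>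

fun lucas_lehmer :: "nat \<Rightarrow> int" where
  "lucas_lehmer 0 = 4"
| "lucas_lehmer (Suc n) = (lucas_lehmer n)\<^sup>2 - 2"

definition unit_root :: zroot3 where "unit_root = ZRoot3 2 1"
definition unit_root' :: zroot3 where "unit_root' = ZRoot3 2 (- 1)"

lemma unit_root_mult: "unit_root * unit_root' = 1" "unit_root' * unit_root = 1"
  by (auto simp: unit_root_def unit_root'_def zroot3_defs)

lemma unit_root_power_mult: "unit_root ^ n * unit_root' ^ n = 1"
  by (simp add: power_mult_distrib[symmetric] unit_root_mult)

text \<open>The unit 2 + sqrt 3 has norm 1 and trace 4. Squaring u + u' with u u' = 1 produces the
  cross term 2, which the recurrence subtracts.\<close>

lemma lucas_lehmer_eq: "of_int (lucas_lehmer n) = unit_root ^ 2 ^ n + unit_root' ^ 2 ^ n"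
proof (induction n)
  case 0
  show ?case by (simp add: unit_root_def unit_root'_def zroot3_defs numeral_zroot3)
next
  case (Suc n)
  have "of_int (lucas_lehmer (Suc n)) = (of_int (lucas_lehmer n))\<^sup>2 - (2 :: zroot3)" by simp
  also have "\<dots> = (unit_root ^ 2 ^ n)\<^sup>2 + (unit_root' ^ 2 ^ n)\<^sup>2
      + 2 * (unit_root ^ 2 ^ n * unit_root' ^ 2 ^ n) - 2"
    unfolding Suc by (simp add: power2_eq_square algebra_simps)
  also have "\<dots> = unit_root ^ 2 ^ Suc n + unit_root' ^ 2 ^ Suc n"
    by (simp add: unit_root_power_mult power_mult[symmetric] mult.commute)
  finally show ?case .
qed

text \<open>Multiplying the trace by the unit \<open>unit_root ^ 2 ^ n\<close> changes no
  divisibility and turns the condition into one about a single power being -1.\<close>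

lemma lucas_lehmer_dvd_iff:
  "m dvd lucas_lehmer n \<longleftrightarrow> of_int m dvd unit_root ^ 2 ^ Suc n + 1"
proof -
  have dvd_of_int: "m dvd lucas_lehmer n \<longleftrightarrow> (of_int m :: zroot3) dvd of_int (lucas_lehmer n)"
    by (simp only: of_int_dvd_zroot3_iff) (simp add: of_int_zroot3)
  have 1: "unit_root ^ 2 ^ Suc n + 1 = unit_root ^ 2 ^ n * of_int (lucas_lehmer n)"
    by (simp add: lucas_lehmer_eq algebra_simps unit_root_power_mult power_add[symmetric] mult_2)
  have 2: "of_int (lucas_lehmer n) = unit_root' ^ 2 ^ n * (unit_root ^ 2 ^ Suc n + 1)"
    unfolding 1 by (simp add: unit_root_power_mult mult.assoc[symmetric]
        mult.commute[of "unit_root' ^ _"])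
  show ?thesis using dvd_of_int 1 2 by (metis dvd_mult)
qed

text \<open>Otherwise \<open>2 ^ m - 1\<close> has a divisor \<open>c\<close> with \<open>1 < c\<close> and \<open>c\<^sup>2 \<le> 2 ^ m - 1\<close>. By \<open>dvd\<close>, \<open>2 + \<surd>3\<close> has order
  \<open>2 ^ m\<close> modulo \<open>c\<close>, but \<open>\<int>[\<surd>3]\<close> has only \<open>c\<^sup>2\<close> residue classes modulo \<open>c\<close>.\<close>

lemma lucas_lehmer_sufficient:
  assumes "m = n + 2" and dvd: "2 ^ m - 1 dvd lucas_lehmer n"
  shows "prime (2 ^ m - 1 :: nat)"
proof (rule ccontr)
  let ?M = "2 ^ m - 1 :: nat"
  assume "\<not> prime ?M"
  have "(2::nat) ^ m \<ge> 2 ^ 2" using assms by (intro power_increasing) auto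
  then have "?M > 1" using assms(1) by (simp only: power2_eq_square)
  moreover have "odd ?M" using assms(1) by simp
  ultimately have M: "?M > 1" "odd ?M" by auto
  obtain a b where ab: "?M = a * b" "1 < a" "1 < b" using M(1) \<open>\<not> prime ?M\<close>
    by (smt (verit) One_nat_def Suc_lessI dvd_div_eq_0_iff dvd_mult_div_cancel dvd_pos_nat gr0I
        mult.right_neutral nat_neq_iff prime_nat_iff div_self less_one)
  define c where "c = min a b"
  have c: "c dvd ?M" "1 < c" "c * c \<le> ?M"
    using ab unfolding c_def by (auto simp: min_def mult_le_mono)
  define w where "w = unit_root"
  have "int ?M = 2 ^ m - 1" by (simp add: of_nat_diff)
  then have "int c dvd lucas_lehmer n" using dvd c(1) by (metis dvd_trans of_nat_dvd_iff)
  then have neg1: "of_int (int c) dvd w ^ 2 ^ Suc n - (- 1)"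
    by (simp only: lucas_lehmer_dvd_iff w_def diff_minus_eq_add)
  \<comment> \<open>Put d = 2^e r with r odd. The power of \<open>w\<close> with exponent 2^(n+1) r
    is -1 as an odd power of -1, but also 1 as a power of \<open>w ^ d\<close>. So \<open>c\<close>
    divides 2, although \<open>?M\<close> is odd.\<close>
  have order: False if d: "0 < d" "d < 2 ^ m" and dv: "of_int (int c) dvd w ^ d - 1" for d
  proof -
    obtain e r where er: "d = 2 ^ e * r" "odd r"
      using multiplicity_decompose'[of d 2] d(1) by (metis not_gr_zero odd_one)
    have "2 ^ e < (2::nat) ^ m"
      using er d by (metis le_less_trans mult_le_mono2 nat_mult_1_right odd_pos Suc_leI One_nat_def)
    then have "e < m" by (rule power_less_imp_less_exp[rotated]) simp
    then have "e \<le> Suc n" using assms(1) by simp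
    then have "2 ^ Suc n * r = d * 2 ^ (Suc n - e)"
      unfolding er by (simp add: power_add[symmetric] del: power_Suc)
    moreover have "of_int (int c) dvd (w ^ 2 ^ Suc n) ^ r - (- 1) ^ r"
      by (rule dvd_power_diff[OF neg1])
    moreover have "of_int (int c) dvd (w ^ d) ^ 2 ^ (Suc n - e) - 1 ^ 2 ^ (Suc n - e)"
      by (rule dvd_power_diff[OF dv])
    ultimately have "of_int (int c) dvd w ^ (d * 2 ^ (Suc n - e)) - (- 1)"
      "of_int (int c) dvd w ^ (d * 2 ^ (Suc n - e)) - 1"
      using er(2) by (simp_all add: power_mult[symmetric] mult.commute)
    then have "of_int (int c) dvd (w ^ (d * 2 ^ (Suc n - e)) - (- 1)) - (w ^ (d * 2 ^ (Suc n - e)) - 1)"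
      by (rule dvd_diff)
    then have "of_int (int c) dvd (2 :: zroot3)" by simp
    then have "int c dvd 2" unfolding of_int_dvd_zroot3_iff numeral_zroot3 by simp
    then have "c dvd 2" using of_nat_dvd_iff[where 'a = int, of c 2] by simp
    then have "c = 2" using c(2) two_is_prime_nat by (auto simp: prime_nat_iff)
    then show False using c(1) M(2) by simp
  qed
  define f where "f i = (rational_part (w ^ i) mod int c, root_part (w ^ i) mod int c)" for i
  have f_less: "i = j" if eq: "f i = f j" and ij: "i < 2 ^ m" "j < 2 ^ m" "i \<le> j" for i j
  proof (rule ccontr)
    assume "i \<noteq> j"
    have "of_int (int c) dvd w ^ j - w ^ i"
      unfolding of_int_dvd_zroot3_iff minus_zroot3_def zroot3.sel
      using eq by (simp add: f_def mod_eq_dvd_iff dvd_diff_commute)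
    then have "of_int (int c) dvd unit_root' ^ i * (w ^ j - w ^ i)" by simp
    moreover have "w ^ j = w ^ i * w ^ (j - i)" using ij by (simp add: power_add[symmetric])
    ultimately have "of_int (int c) dvd (w ^ i * unit_root' ^ i) * (w ^ (j - i) - 1)"
      by (simp add: algebra_simps)
    then have "of_int (int c) dvd w ^ (j - i) - 1" by (simp add: w_def unit_root_power_mult)
    moreover have "0 < j - i" "j - i < 2 ^ m" using ij \<open>i \<noteq> j\<close> by linarith+
    ultimately show False using order by blast
  qed
  have "inj_on f {..<2 ^ m}"
    by (rule inj_onI) (metis f_less lessThan_iff nle_le)
  moreover have "f ` {..<2 ^ m} \<subseteq> {0..<int c} \<times> {0..<int c}"
    using c(2) by (auto simp: f_def)
  ultimately have "card {..<(2::nat) ^ m} \<le> card ({0..<int c} \<times> {0..<int c})"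
    by (intro card_inj_on_le) auto
  then have "2 ^ m \<le> c * c" by simp
  then show False using c(3) M(1) by linarith
qed

text \<open>Let \<open>p = 2 ^ m - 1\<close> be prime. Then 2 is a square and 3 a nonsquare modulo \<open>p\<close>, hence
  \<open>(1 + \<surd>3) ^ p \<equiv> 1 - \<surd>3\<close> and \<open>(1 + \<surd>3) ^ (p + 1) \<equiv> - 2\<close>. The claim follows because
  \<open>(1 + \<surd>3)\<^sup>2 = 2 * (2 + \<surd>3)\<close>.\<close>

lemma lucas_lehmer_necessary:
  assumes "m = n + 2" "n \<ge> 1" and prime: "prime (2 ^ m - 1 :: nat)"
  shows "2 ^ m - 1 dvd lucas_lehmer n"
proof -
  define p where "p = (2 ^ m - 1 :: nat)"
  obtain l where n: "n = Suc l" using assms(2) by (cases n) auto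
  have p_int: "int p = 8 * 2 ^ l - 1" and p8: "p = 8 * 2 ^ l - 1"
    by (simp_all add: p_def assms(1) n of_nat_diff)
  have "(1::nat) \<le> 2 ^ l" by simp
  then have p7: "p \<ge> 7" using p8 by linarith
  have pprime: "prime p" using prime p_def by simp
  have mod3: "(2::int) ^ (2 * i) mod 3 = 1" for i
    by (simp add: power_mult power_mod[of 4, symmetric, simplified])
  \<comment> \<open>For even \<open>m\<close>, 3 would divide \<open>p\<close>. Oddness is used
    twice: it gives \<open>p\<close> the residue 1 modulo 3, and it makes \<open>m + 1\<close>
    even.\<close>
  have "odd m"
  proof
    assume "even m"
    then obtain i where "m = 2 * i" by auto
    then have "(2 ^ m - 1 :: int) mod 3 = 0" by (simp add: mod3 mod_diff_left_eq[symmetric])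
    then have "3 dvd int p" by (simp add: p_def of_nat_diff dvd_eq_mod_eq_0)
    then have "3 dvd p" using of_nat_dvd_iff[where 'a = int, of 3 p] by simp
    then have "p = 3" using pprime by (auto simp: prime_nat_iff)
    then show False using p7 by simp
  qed
  then obtain i where i: "m = Suc (2 * i)" by (metis oddE Suc_eq_plus1)
  have "int p mod 3 = 1"
  proof -
    have "(2 * 2 ^ (2 * i) - 1 :: int) mod 3 = (2 * (2 ^ (2 * i) mod 3) - 1) mod 3"
      by (metis mod_diff_left_eq mod_mult_right_eq)
    then show ?thesis by (simp add: mod3 p_def i of_nat_diff)
  qed
  have p2: "p > 2" using p7 by simp
  have "p \<noteq> 3" using p7 by simp
  \<comment> \<open>The residue 1 is a square modulo 3. As \<open>(p - 1) div 2\<close> is odd,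
    reciprocity flips the sign, so 3 is a nonsquare modulo \<open>p\<close>.\<close>
  have "Legendre (int p) (int 3) = 1"
  proof -
    have "[int p = 1] (mod 3)" using \<open>int p mod 3 = 1\<close> by (simp add: cong_def)
    moreover have "QuadRes 3 (int p)" unfolding QuadRes_def using \<open>int p mod 3 = 1\<close>
      by (intro exI[of _ 1]) (simp add: cong_def)
    ultimately show ?thesis by (auto simp: Legendre_def cong_def)
  qed
  moreover have "Legendre (int p) (int 3) * Legendre (int 3) (int p) =
      (- 1) ^ ((p - 1) div 2 * ((3 - 1) div 2))"
    using pprime p2 \<open>p \<noteq> 3\<close> by (intro Quadratic_Reciprocity) auto
  moreover have half: "(p - 1) div 2 = 4 * 2 ^ l - 1" by (simp add: p8)
  moreover have "odd (4 * 2 ^ l - 1 :: nat)" by simp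
  ultimately have "Legendre 3 (int p) = - 1" by simp
  then have three: "[- 1 = 3 ^ ((p - 1) div 2)] (mod int p)"
    using euler_criterion[of p 3] pprime p2 by simp
  have "[(2::int) ^ m = 1] (mod int p)"
    by (simp add: cong_iff_dvd_diff p_def of_nat_diff)
  \<comment> \<open>Modulo \<open>p\<close>, 2 equals 2^(m+1), a square because \<open>m + 1\<close>
    is even.\<close>
  then have "[2 * 2 ^ m = 2 * 1] (mod int p)" by (rule cong_mult[OF cong_refl])
  moreover have "2 * 2 ^ m = ((2::int) ^ Suc i)\<^sup>2"
    by (simp add: i power_mult[symmetric] mult.commute power_even_eq)
  ultimately have "[((2::int) ^ Suc i)\<^sup>2 = 2] (mod int p)" by simp
  then have "QuadRes (int p) 2" unfolding QuadRes_def by (auto intro!: exI[of _ "2 ^ Suc i"])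
  moreover have "\<not> [2 = 0] (mod int p)" using p2 by (auto simp: cong_iff_dvd_diff dest: zdvd_imp_le)
  ultimately have "Legendre 2 (int p) = 1" by (simp add: Legendre_def)
  then have two: "[1 = 2 ^ ((p - 1) div 2)] (mod int p)"
    using euler_criterion[of p 2] pprime p2 by simp

  define s where "s = ZRoot3 0 1"
  define w where "w = unit_root"
  define P where "P = (of_int (int p) :: zroot3)"
  have P_nat: "P = of_nat p" by (simp add: P_def)
  define h where "h = (p - 1) div 2"
  \<comment> \<open>Thus (p + 1) / 2 is exactly the exponent occurring in
    \<open>lucas_lehmer_dvd_iff\<close>.\<close>
  have ph: "p = Suc (2 * h)" and ph2: "Suc h = 2 ^ Suc n"
    unfolding h_def half using p7 p8 by (simp_all add: n)
  have s2: "s\<^sup>2 = 3" by (simp add: s_def zroot3_defs numeral_zroot3 power2_eq_square)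
  have "P dvd (of_int (3 ^ h) - of_int (- 1))"
    using cong_sym[OF three[folded h_def]]
    unfolding P_def of_int_diff[symmetric] of_int_dvd_zroot3_iff
    by (simp add: of_int_zroot3 cong_iff_dvd_diff minus_zroot3_def)
  then have three': "P dvd 3 ^ h + 1" by simp
  have "P dvd (of_int (2 ^ h) - of_int 1)"
    using cong_sym[OF two[folded h_def]]
    unfolding P_def of_int_diff[symmetric] of_int_dvd_zroot3_iff
    by (simp add: of_int_zroot3 cong_iff_dvd_diff minus_zroot3_def)
  then have two': "P dvd 2 ^ h - 1" by simp
  have "P dvd (1 + s) ^ p - (1 ^ p + s ^ p)"
    unfolding P_nat by (rule prime_dvd_add_power_diff[OF pprime])
  moreover have "s ^ p = 3 ^ h * s" by (simp add: ph power_mult s2)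
  \<comment> \<open>By Euler's criterion \<open>3 ^ h\<close> is -1, so adding this multiple of
    \<open>P\<close> replaces \<open>3 ^ h * s\<close> by \<open>- s\<close>.\<close>
  ultimately have "P dvd (1 + s) ^ p - (1 + 3 ^ h * s) + (3 ^ h + 1) * s"
    using three' by (intro dvd_add) auto
  then have "P dvd (1 + s) ^ p - (1 - s)" by (simp add: algebra_simps)
  then have "P dvd (1 + s) * ((1 + s) ^ p - (1 - s))" by (rule dvd_mult)
  also have "(1 + s) * ((1 + s) ^ p - (1 - s)) = ((1 + s)\<^sup>2) ^ Suc h + 2"
    unfolding power_mult[symmetric] by (simp add: ph algebra_simps s2[unfolded power2_eq_square])
  also have "(1 + s)\<^sup>2 = 2 * w"
    by (simp add: s_def w_def unit_root_def zroot3_defs numeral_zroot3 power2_eq_square)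
  \<comment> \<open>The second summand is a multiple of \<open>P\<close> because
    \<open>2 ^ h\<close> is 1 modulo \<open>p\<close>.\<close>
  also have "(2 * w) ^ Suc h + 2 = 2 * (w ^ Suc h + 1) + 2 * (2 ^ h - 1) * w ^ Suc h"
    by (simp add: power_mult_distrib algebra_simps)
  finally have "P dvd 2 * (w ^ Suc h + 1)"
    by (rule dvd_add_left_iff[THEN iffD1, rotated]) (intro dvd_mult2 dvd_mult two')
  \<comment> \<open>The factor 2 is cancelled by its inverse \<open>2 ^ (m - 1)\<close>, since
    \<open>2 ^ m\<close> is \<open>P + 1\<close>.\<close>
  then have "P dvd of_int (2 ^ (m - 1)) * (2 * (w ^ Suc h + 1))" by simp
  also have "of_int (2 ^ (m - 1)) * (2 * (w ^ Suc h + 1)) = 2 ^ m * (w ^ Suc h + 1)"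
    by (simp add: i algebra_simps)
  also have "(2 :: zroot3) ^ m = P + 1" by (simp add: P_nat p_def of_nat_diff)
  finally have "P dvd w ^ Suc h + 1"
    by (simp add: distrib_right dvd_add_right_iff)
  then have "int p dvd lucas_lehmer n"
    unfolding lucas_lehmer_dvd_iff ph2 w_def P_def .
  then show ?thesis by (simp add: p_def of_nat_diff)
qed

text \<open>The bound is sharp: for \<open>m = 2\<close> the prime 3 does not divide the start value
  4. Hence exponents up to 2 are never tested.\<close>

theorem lucas_lehmer_test:
  assumes "m \<ge> 3"
  shows "prime (2 ^ m - 1 :: nat) \<longleftrightarrow> 2 ^ m - 1 dvd lucas_lehmer (m - 2)"
  using assms lucas_lehmer_sufficient[of m "m - 2"] lucas_lehmer_necessary[of m "m - 2"] by auto

section \<open>Arithmetic modulo \<open>2 ^ k - 1\<close> on bit vectors\<close>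

definition bits_value :: "nat \<Rightarrow> (nat \<Rightarrow> bool) \<Rightarrow> nat" where
  "bits_value k a = (\<Sum>i<k. of_bool (a i) * 2 ^ i)"

text \<open>The carry into position \<open>i\<close>, so index \<open>k\<close> gives the carry out
  of a \<open>k\<close>-bit addition; the conditional is the majority of three bits.\<close>

primrec carries :: "(nat \<Rightarrow> bool) \<Rightarrow> (nat \<Rightarrow> bool) \<Rightarrow> bool \<Rightarrow> nat \<Rightarrow> bool" where
  "carries a b c 0 = c"
| "carries a b c (Suc i) = (if a i then b i \<or> carries a b c i else b i \<and> carries a b c i)"

definition sum_bits :: "(nat \<Rightarrow> bool) \<Rightarrow> (nat \<Rightarrow> bool) \<Rightarrow> bool \<Rightarrow> nat \<Rightarrow> bool" where
  "sum_bits a b c i = (a i \<noteq> (b i \<noteq> carries a b c i))"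

primrec shift :: "'a \<Rightarrow> (nat \<Rightarrow> 'a) \<Rightarrow> nat \<Rightarrow> 'a" where
  "shift r b 0 = r"
| "shift r b (Suc i) = b i"

lemma bits_value_less: "bits_value k a < 2 ^ k"
proof (induction k)
  case (Suc k)
  have "of_bool (a k) * 2 ^ k \<le> (2 :: nat) ^ k" by simp
  then have "bits_value k a + of_bool (a k) * 2 ^ k < 2 ^ k + 2 ^ k"
    using Suc by (intro add_less_le_mono)
  then show ?case by (simp add: bits_value_def)
qed (simp add: bits_value_def)

lemma bits_value_sum_bits:
  "bits_value k a + bits_value k b + of_bool c =
     bits_value k (sum_bits a b c) + of_bool (carries a b c k) * 2 ^ k"
proof (induction k)
  case (Suc k)
  have "bits_value (Suc k) a + bits_value (Suc k) b + of_bool c =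
      (bits_value k a + bits_value k b + of_bool c) + of_bool (a k) * 2 ^ k + of_bool (b k) * 2 ^ k"
    by (simp add: bits_value_def)
  also have "\<dots> = bits_value (Suc k) (sum_bits a b c) + of_bool (carries a b c (Suc k)) * 2 ^ Suc k"
    unfolding Suc by (auto simp: bits_value_def sum_bits_def)
  finally show ?case .
qed (simp add: bits_value_def)

text \<open>The bit leaving at the top has weight 2^(k+1), the entering bit \<open>r\<close> has
  weight 1. For \<open>r = b k\<close> the shift is a rotation, which is doubling modulo 2^(k+1) -
  1.\<close>

lemma bits_value_shift:
  "bits_value (Suc k) (shift r b) + of_bool (b k) * 2 ^ Suc k = of_bool r + 2 * bits_value (Suc k) b"
  unfolding bits_value_def
  by (subst sum.lessThan_Suc_shift) (simp add: sum_distrib_left mult.left_commute del: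
      sum_of_bool_mult_eq)

lemma bits_value_False [simp]: "bits_value k (\<lambda>i. False) = 0"
  by (simp add: bits_value_def)

lemma all_bits_iff: "(\<forall>i<k. a i) \<longleftrightarrow> bits_value k a = 2 ^ k - 1"
proof (induction k)
  case (Suc k)
  have "bits_value k a < 2 ^ k" by (rule bits_value_less)
  moreover have "2 * 2 ^ k - 1 \<noteq> (2 ^ k - 1 :: nat)"
    using zero_less_power[of "2 :: nat" k] by linarith
  ultimately show ?case using Suc by (cases "a k") (auto simp: bits_value_def less_Suc_eq)
qed (simp add: bits_value_def)

text \<open>The number represented by an accumulator \<open>a\<close> with pending carry \<open>c\<close> is the sum of both, modulo
  \<open>2 ^ k - 1\<close>: the carry out of the top position has weight \<open>2 ^ k\<close>, so it can serve as the carry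
  into the next addition.\<close>

fun mult_round :: "nat \<Rightarrow> bool \<Rightarrow> (nat \<Rightarrow> bool) \<times> (nat \<Rightarrow> bool) \<times> bool \<Rightarrow> (nat \<Rightarrow> bool) \<times> (nat \<Rightarrow> bool) \<times>
    bool" where
  "mult_round k x (a, b, c) =
     (sum_bits a (\<lambda>i. x \<and> b i) c, shift (b (k - 1)) b, carries a (\<lambda>i. x \<and> b i) c k)"

fun represents :: "nat \<Rightarrow> (nat \<Rightarrow> bool) \<times> (nat \<Rightarrow> bool) \<times> bool \<Rightarrow> int \<Rightarrow> int \<Rightarrow> bool" where
  "represents k (a, b, c) u v \<longleftrightarrow>
     0 < bits_value k a + of_bool c \<and>
     [int (bits_value k a + of_bool c) = u] (mod 2 ^ k - 1) \<and>
     [int (bits_value k b) = v] (mod 2 ^ k - 1)"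

lemma cong_power_2: "[2 ^ k = 1] (mod (2 ^ k - 1 :: int))"
  by (simp add: cong_iff_dvd_diff)

text \<open>The invariant of shift-and-add multiplication: \<open>u\<close> collects partial
  products while \<open>v\<close> doubles.\<close>

lemma represents_mult_round:
  assumes "k > 0" "represents k s u v"
  shows "represents k (mult_round k x s) (u + of_bool x * v) (2 * v)"
proof -
  let ?M = "2 ^ k - 1 :: int"
  obtain a b c where s: "s = (a, b, c)" by (cases s)
  obtain l where l: "k = Suc l" using assms(1) by (cases k) auto
  define b' where "b' = (\<lambda>i. x \<and> b i)"
  have sum: "bits_value k a + bits_value k b' + of_bool c =
      bits_value k (sum_bits a b' c) + of_bool (carries a b' c k) * 2 ^ k"
    by (rule bits_value_sum_bits)
  have b': "bits_value k b' = of_bool x * bits_value k b"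
    by (cases x) (simp_all add: b'_def)
  \<comment> \<open>A positive left-hand side of \<open>sum\<close> forces a nonzero new accumulator
    or a carry. The congruence alone would allow the word of zeros.\<close>
  have "0 < bits_value k (sum_bits a b' c) + of_bool (carries a b' c k)"
    using sum assms(2) by (auto simp: s)
  moreover have "[int (bits_value k (sum_bits a b' c) + of_bool (carries a b' c k)) =
      u + of_bool x * v] (mod ?M)"
  proof -
    have "[int (bits_value k (sum_bits a b' c)) + of_bool (carries a b' c k) * 1
        = int (bits_value k (sum_bits a b' c)) + of_bool (carries a b' c k) * 2 ^ k] (mod ?M)"
      by (intro cong_add cong_mult cong_refl cong_sym[OF cong_power_2])
    also have "int (bits_value k (sum_bits a b' c)) + of_bool (carries a b' c k) * 2 ^ k
        = int (bits_value k a + of_bool c) + of_bool x * int (bits_value k b)"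
      using arg_cong[OF sum, of int] by (simp add: b')
    also have "[\<dots> = u + of_bool x * v] (mod ?M)"
      using assms(2) by (intro cong_add cong_mult cong_refl) (auto simp: s)
    finally show ?thesis by simp
  qed
  moreover have "[int (bits_value k (shift (b (k - 1)) b)) = 2 * v] (mod ?M)"
  proof -
    have "int (bits_value k (shift (b l) b)) + of_bool (b l) * 2 ^ k =
        of_bool (b l) + 2 * int (bits_value k b)"
      using arg_cong[OF bits_value_shift[of l "b l" b], of int] by (simp add: l)
    then have "int (bits_value k (shift (b l) b)) = 2 * int (bits_value k b) - of_bool (b l) * ?M"
      by (simp add: algebra_simps)
    then have "[int (bits_value k (shift (b l) b)) = 2 * int (bits_value k b)] (mod ?M)"
      by (simp add: cong_iff_dvd_diff)
    also have "[2 * int (bits_value k b) = 2 * v] (mod ?M)"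
      using assms(2) by (intro cong_mult cong_refl) (auto simp: s)
    finally show ?thesis by (simp add: l)
  qed
  ultimately show ?thesis by (simp add: s b'_def)
qed

text \<open>The initial accumulator has the value \<open>2 ^ k - 3\<close>, which is \<open>- 2\<close> modulo \<open>2 ^ k - 1\<close>. The two
  rounds that \<open>square_rounds\<close> adds absorb the pending carry. Since the represented number is never 0,
  the residue class 0 can only appear as \<open>2 ^ k - 1\<close>, i.e. as a word of ones.\<close>

primrec mult_rounds :: "nat \<Rightarrow> (nat \<Rightarrow> bool) \<Rightarrow> nat \<Rightarrow> (nat \<Rightarrow> bool) \<times> (nat \<Rightarrow> bool) \<times> bool" where
  "mult_rounds k s 0 = ((\<lambda>i. i \<noteq> 1), s, False)"
| "mult_rounds k s (Suc j) = mult_round k (s j) (mult_rounds k s j)"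

definition square_rounds :: "nat \<Rightarrow> (nat \<Rightarrow> bool) \<Rightarrow> (nat \<Rightarrow> bool) \<times> (nat \<Rightarrow> bool) \<times> bool" where
  "square_rounds k s = mult_round k False (mult_round k False (mult_rounds k s k))"

lemma bits_value_init:
  assumes "k \<ge> 2"
  shows "bits_value k (\<lambda>i. i \<noteq> 1) = 2 ^ k - 3"
  using assms
proof (induction rule: dec_induct)
  case base
  show ?case by (simp add: bits_value_def numeral_2_eq_2)
next
  case (step k)
  have "(2::nat) ^ 2 \<le> 2 ^ k" using step by (intro power_increasing) auto
  then show ?case using step by (simp add: bits_value_def)
qed

lemma square_rounds_correct:
  assumes k: "k \<ge> 2" and "square_rounds k s = (a, b, c)"
  shows "[int (bits_value k a) = (int (bits_value k s))\<^sup>2 - 2] (mod 2 ^ k - 1)" "bits_value k a > 0"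
proof -
  let ?v = "int (bits_value k s)"
  have pow: "(2::nat) ^ 2 \<le> 2 ^ k" using k by (intro power_increasing) auto
  \<comment> \<open>After \<open>j\<close> rounds the \<open>j\<close> low bits of the multiplier
    have been used, on top of the initial -2.\<close>
  have "represents k (mult_rounds k s j) (- 2 + int (bits_value j s) * ?v) (2 ^ j * ?v)" for j
  proof (induction j)
    case 0
    show ?case using bits_value_init[OF k] pow
      by (simp add: of_nat_diff cong_iff_dvd_diff) (simp add: bits_value_def)
  next
    case (Suc j)
    show ?case using represents_mult_round[OF _ Suc, of "s j"] k
      by (simp add: bits_value_def algebra_simps)
  qed
  from this[of k] have rep: "represents k (mult_rounds k s k) (?v\<^sup>2 - 2) (2 ^ k * ?v)"
    by (simp add: power2_eq_square)
  obtain a0 b0 c0 where 0: "mult_rounds k s k = (a0, b0, c0)" by (cases "mult_rounds k s k")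
  obtain a1 b1 c1 where 1: "mult_round k False (a0, b0, c0) = (a1, b1, c1)"
    by (cases "mult_round k False (a0, b0, c0)")
  have 2: "mult_round k False (a1, b1, c1) = (a, b, c)" using assms(2) unfolding square_rounds_def 0 1 .
  have "represents k (a1, b1, c1) (?v\<^sup>2 - 2) (2 * (2 ^ k * ?v))"
    using represents_mult_round[of k "(a0, b0, c0)" _ _ False, unfolded 1] rep[unfolded 0] k by auto
  from represents_mult_round[OF _ this, of False, unfolded 2] k
  have rep': "represents k (a, b, c) (?v\<^sup>2 - 2) (2 * (2 * (2 ^ k * ?v)))" by auto
  have sum0: "bits_value k a0 + of_bool c0 = bits_value k a1 + of_bool c1 * 2 ^ k"
    using bits_value_sum_bits[of k a0 "\<lambda>_. False" c0] 1 by auto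
  have sum1: "bits_value k a1 + of_bool c1 = bits_value k a + of_bool c * 2 ^ k"
    using bits_value_sum_bits[of k a1 "\<lambda>_. False" c1] 2 by auto
  \<comment> \<open>A carry out of the second extra round would require the first one to leave all
    ones and a pending carry. That amounts to at least 2^(k+1) - 1, but the first extra round starts
    with at most 2^k.\<close>
  have "\<not> c"
  proof
    assume c
    then have "bits_value k a1 + of_bool c1 \<ge> 2 ^ k" using sum1 by simp
    then have "c1" "bits_value k a1 \<ge> 2 ^ k - 1" using bits_value_less[of k a1] by (cases c1; simp)+
    then have "bits_value k a0 + of_bool c0 \<ge> 2 ^ k - 1 + 2 ^ k" using sum0 by simp
    moreover have "bits_value k a0 + of_bool c0 \<le> 2 ^ k" using bits_value_less[of k a0] by simp
    ultimately show False using pow by simp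
  qed
  then show "[int (bits_value k a) = ?v\<^sup>2 - 2] (mod 2 ^ k - 1)" "bits_value k a > 0"
    using rep' by auto
qed

primrec lucas_lehmer_bits :: "nat \<Rightarrow> nat \<Rightarrow> nat \<Rightarrow> bool" where
  "lucas_lehmer_bits k 0 = (\<lambda>i. i = 2)"
| "lucas_lehmer_bits k (Suc j) = fst (square_rounds k (lucas_lehmer_bits k j))"

lemma lucas_lehmer_bits_correct:
  assumes "k \<ge> 3"
  shows "[int (bits_value k (lucas_lehmer_bits k j)) = lucas_lehmer j] (mod 2 ^ k - 1) \<and>
    bits_value k (lucas_lehmer_bits k j) > 0"
proof (induction j)
  case 0
  have "bits_value k (\<lambda>i. i = 2) = (\<Sum>i<k. if i = 2 then 2 ^ i else 0)"
    unfolding bits_value_def by (intro sum.cong) auto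
  also have "\<dots> = 4" using assms by (simp add: sum.delta)
  finally show ?case by simp
next
  case (Suc j)
  obtain a b c where s: "square_rounds k (lucas_lehmer_bits k j) = (a, b, c)"
    by (cases "square_rounds k (lucas_lehmer_bits k j)")
  have "[(int (bits_value k (lucas_lehmer_bits k j)))\<^sup>2 - 2 = (lucas_lehmer j)\<^sup>2 - 2] (mod 2 ^ k - 1)"
    using Suc by (intro cong_diff cong_pow) auto
  then show ?case using square_rounds_correct[OF _ s] assms
    by (auto simp: s intro: cong_trans)
qed

text \<open>The computed value lies strictly between 0 and 2^k, where 2^k - 1 is the only multiple
  of itself, and its word consists of ones.\<close>

theorem all_lucas_lehmer_bits_iff:
  assumes "k \<ge> 3"
  shows "(\<forall>i<k. lucas_lehmer_bits k (k - 2) i) \<longleftrightarrow> prime (2 ^ k - 1 :: nat)"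
proof -
  define v where "v = bits_value k (lucas_lehmer_bits k (k - 2))"
  have v: "[int v = lucas_lehmer (k - 2)] (mod 2 ^ k - 1)" "0 < v" "v < 2 ^ k"
    using lucas_lehmer_bits_correct[OF assms, of "k - 2"] bits_value_less by (auto simp: v_def)
  have M: "int (2 ^ k - 1) = 2 ^ k - 1" by (simp add: of_nat_diff)
  have "prime (2 ^ k - 1 :: nat) \<longleftrightarrow> 2 ^ k - 1 dvd lucas_lehmer (k - 2)"
    by (rule lucas_lehmer_test[OF assms])
  also have "\<dots> \<longleftrightarrow> int (2 ^ k - 1) dvd int v" using v(1) unfolding M by (simp add: cong_dvd_iff)
  also have "\<dots> \<longleftrightarrow> 2 ^ k - 1 dvd v" by (rule of_nat_dvd_iff)
  also have "\<dots> \<longleftrightarrow> v = 2 ^ k - 1" using v by (auto dest: dvd_imp_le)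
  also have "\<dots> \<longleftrightarrow> (\<forall>i<k. lucas_lehmer_bits k (k - 2) i)"
    unfolding v_def by (rule all_bits_iff[symmetric])
  finally show ?thesis by simp
qed

section \<open>Mersenne primes under the Lenstra--Pomerance--Wagstaff conjecture\<close>

lemma LPW_eventually_mersenne_count_less:
  fixes \<epsilon> :: real
  assumes "Lenstra_Pomerance_Wagstaff" "\<epsilon> > 0"
  shows "eventually (\<lambda>n. mersenne_count n < mersenne_count (nat \<lfloor>real n powr (1 + \<epsilon>)\<rfloor>)) sequentially"
proof -
  define e where "e = exp (euler_mascheroni :: real)"
  define q where "q n = real (mersenne_count n) / (e * log 2 (real n))" for n
  define r where "r n = nat \<lfloor>real n powr (1 + \<epsilon>)\<rfloor>" for n :: nat
  have q: "q \<longlonglongrightarrow> 1"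
    using assms(1) unfolding Lenstra_Pomerance_Wagstaff_def q_def e_def by blast
  have "filterlim r at_top sequentially"
    unfolding r_def using assms(2) by real_asymp
  then have qr: "(\<lambda>n. q (r n)) \<longlonglongrightarrow> 1"
    by (rule filterlim_compose[OF q])
  have "(\<lambda>n. log 2 (real (r n)) / log 2 (real n)) \<longlonglongrightarrow> 1 + \<epsilon>"
    unfolding r_def using assms(2) by real_asymp
  \<comment> \<open>The quotient of logarithms renormalises \<open>q (r n)\<close>, so that both
    counts have the denominator \<open>e * log 2 n\<close>. The limit of the difference is
    \<epsilon>.\<close>
  then have "(\<lambda>n. q (r n) * (log 2 (real (r n)) / log 2 (real n)) - q n) \<longlonglongrightarrow> 1 * (1 + \<epsilon>) - 1"
    by (intro tendsto_diff tendsto_mult qr q)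
  then have "eventually (\<lambda>n. q (r n) * (log 2 (real (r n)) / log 2 (real n)) - q n > 0) sequentially"
    using assms(2) by (intro order_tendstoD(1)) auto
  moreover have "eventually (\<lambda>n. r n > 1) sequentially"
    using \<open>filterlim r at_top sequentially\<close> by (simp add: filterlim_at_top
        eventually_mono[of "\<lambda>n. 2 \<le> r n"])
  ultimately show ?thesis
    using eventually_gt_at_top[of 1]
  proof eventually_elim
    case (elim n)
    have pos: "log 2 (real (r n)) > 0" "log 2 (real n) > 0" "e > 0"
      using elim by (auto simp: e_def)
    have "0 < real (mersenne_count (r n)) / (e * log 2 (real n)) - real (mersenne_count n) /
        (e * log 2 (real n))"
      using elim(1) pos by (simp add: q_def)
    also have "\<dots> = (real (mersenne_count (r n)) - real (mersenne_count n)) / (e * log 2 (real n))"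
      by (simp add: diff_divide_distrib)
    finally have "0 < real (mersenne_count (r n)) - real (mersenne_count n)"
      using mult_pos_pos[OF pos(3,2)] by (metis less_asym zero_less_divide_iff)
    then show ?case by (simp add: r_def)
  qed
qed

lemma mersenne_count_less_imp:
  assumes "mersenne_count n < mersenne_count n'"
  obtains p where "mersenne_prime p" "n < bin_length p" "bin_length p \<le> n'"
proof -
  have "\<not> {p. mersenne_prime p \<and> bin_length p \<le> n'} \<subseteq> {p. mersenne_prime p \<and> bin_length p \<le> n}"
  proof
    assume "{p. mersenne_prime p \<and> bin_length p \<le> n'} \<subseteq> {p. mersenne_prime p \<and> bin_length p \<le> n}"
    then have "mersenne_count n' \<le> mersenne_count n"
      unfolding mersenne_count_def by (intro card_mono finite_bin_length_le)
    then show False using assms by simp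
  qed
  then show ?thesis using that not_le by blast
qed

lemma LPW_nongappy_mersenne_primes:
  fixes \<epsilon> :: real
  assumes "Lenstra_Pomerance_Wagstaff" "\<epsilon> > 0"
  obtains N0 where "\<And>N. N \<ge> N0 \<Longrightarrow> nongappy (\<lambda>t. t powr (1 + \<epsilon>)) {p. mersenne_prime p \<and> N < bin_length p}"
proof -
  obtain N0 where N0: "\<And>n. n \<ge> N0 \<Longrightarrow>
      mersenne_count n < mersenne_count (nat \<lfloor>real n powr (1 + \<epsilon>)\<rfloor>)"
    using LPW_eventually_mersenne_count_less[OF assms] by (auto simp: eventually_sequentially)
  show ?thesis
  proof (rule that)
    fix N assume N: "N \<ge> N0"
    let ?S = "{p. mersenne_prime p \<and> N < bin_length p}"
    \<comment> \<open>Nonemptiness comes from infinitude: only finitely many numbers have length at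
      most \<open>N\<close>.\<close>
    have "{p. mersenne_prime p} \<noteq> {p. mersenne_prime p \<and> bin_length p \<le> N}"
      using assms(1) finite_bin_length_le[of mersenne_prime N]
      unfolding Lenstra_Pomerance_Wagstaff_def by metis
    then have "?S \<noteq> {}" by (auto simp: not_le)
    moreover have "\<exists>m'\<in>?S. m' > m \<and> real (bin_length m') \<le> real (bin_length m) powr (1 + \<epsilon>)"
      if m: "m \<in> ?S" for m
    proof -
      obtain p where p: "mersenne_prime p" "bin_length m < bin_length p"
        "bin_length p \<le> nat \<lfloor>real (bin_length m) powr (1 + \<epsilon>)\<rfloor>"
        using N0[of "bin_length m"] m N by (auto elim!: mersenne_count_less_imp)
      have "m < p"
      proof (rule ccontr)
        assume "\<not> m < p"
        then have "bin_length p \<le> bin_length m" by (intro floorlog_mono) auto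
        then show False using p(2) by simp
      qed
      moreover have "real (bin_length p) \<le> real (bin_length m) powr (1 + \<epsilon>)"
        using p(3) by (simp add: le_nat_floor le_nat_iff le_floor_iff)
      ultimately show ?thesis using p m by auto
    qed
    moreover have "?S \<subseteq> {0<..}"
      using prime_gt_0_nat by (auto simp only: mersenne_prime_def greaterThan_iff)
    ultimately show "nongappy (\<lambda>t. t powr (1 + \<epsilon>)) ?S"
      unfolding nongappy_def by blast
  qed
qed

section \<open>Binary words of Mersenne numbers\<close>

lemma bin_length_mersenne: "bin_length (2 ^ k - 1) = k"
proof (cases k)
  case (Suc j)
  have "(2::nat) ^ j \<ge> 1" by simp
  then have "(2::nat) ^ j \<le> 2 ^ k - 1" "(2::nat) ^ k - 1 < 2 ^ k" by (simp_all add: Suc)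
  then show ?thesis by (intro antisym floorlog_leI floorlog_geI) (simp_all add: Suc)
qed (simp add: floorlog_def)

lemma binary_mersenne: "binary (2 ^ k - 1) = replicate k True"
proof -
  have "bit (2 ^ k - 1 :: nat) i \<longleftrightarrow> i < k" for i
    unfolding mask_eq_exp_minus_1[symmetric] by (simp add: bit_mask_iff)
  then have "map (bit (2 ^ k - 1 :: nat)) [0..<k] = replicate k True"
    by (intro nth_equalityI) auto
  then show ?thesis by (simp only: binary_def bin_length_mersenne rev_replicate)
qed

section \<open>Structured programs for Turing machines\<close>

type_synonym update = "nat \<times> (nat list \<Rightarrow> nat) \<times> move"

text \<open>All functions \<open>g\<close> see the symbols scanned before the step, so updates of
  several tapes are simultaneous. Unlisted tapes rewrite their symbol and stay.\<close>

definition updates :: "update list \<Rightarrow> nat list \<Rightarrow> (nat \<times> move) list" where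
  "updates us ss = fold (\<lambda>(i, g, d) as. as[i := (g ss, d)]) us (map (\<lambda>s. (s, Stay)) ss)"

definition apply_updates :: "update list \<Rightarrow> tape list \<Rightarrow> tape list" where
  "apply_updates us ts = map2 act (updates us (map scanned ts)) ts"

datatype prog =
    Act "update list"
  | Seq prog prog (infixr ";;" 60)
  | While nat "nat \<Rightarrow> bool" prog
  | When nat "nat \<Rightarrow> bool" prog

text \<open>The counter charges 1 for every test and 1 for the jump back after a loop body, which
  makes it equal to the number of machine steps of the compiled code.\<close>

inductive exec :: "prog \<Rightarrow> tape list \<Rightarrow> nat \<Rightarrow> tape list \<Rightarrow> bool" where
  Act: "exec (Act us) ts 1 (apply_updates us ts)"
| Seq: "exec p ts t ts' \<Longrightarrow> exec q ts' t' ts'' \<Longrightarrow> exec (p ;; q) ts (t' + t) ts''"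
| While_False: "\<not> C (map scanned ts ! i) \<Longrightarrow> exec (While i C p) ts 1 ts"
| While_True: "C (map scanned ts ! i) \<Longrightarrow> exec p ts t ts' \<Longrightarrow> exec (While i C p) ts' t' ts''
    \<Longrightarrow> exec (While i C p) ts (t' + Suc (t + 1)) ts''"
| When_False: "\<not> C (map scanned ts ! i) \<Longrightarrow> exec (When i C p) ts 1 ts"
| When_True: "C (map scanned ts ! i) \<Longrightarrow> exec p ts t ts' \<Longrightarrow> exec (When i C p) ts (t + 1) ts'"

section \<open>Compilation to a transition function\<close>

datatype instr = Do "update list" | Branch nat "nat \<Rightarrow> bool" nat

primrec code_size :: "prog \<Rightarrow> nat" where
  "code_size (Act us) = 1"
| "code_size (p ;; q) = code_size p + code_size q"
| "code_size (While i C p) = code_size p + 2"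
| "code_size (When i C p) = code_size p + 1"

text \<open>States are program counters and jump targets are absolute, hence the argument
  \<open>a\<close>, the address of the first instruction. The end of the whole code is the halting
  state.\<close>

primrec compile :: "prog \<Rightarrow> nat \<Rightarrow> instr list" where
  "compile (Act us) a = [Do us]"
| "compile (p ;; q) a = compile p a @ compile q (a + code_size p)"
| "compile (While i C p) a =
     Branch i (\<lambda>s. \<not> C s) (a + code_size p + 2) # compile p (a + 1) @ [Branch 0 (\<lambda>_. True) a]"
| "compile (When i C p) a = Branch i (\<lambda>s. \<not> C s) (a + code_size p + 1) # compile p (a + 1)"

lemma length_compile [simp]: "length (compile p a) = code_size p"
  by (induction p arbitrary: a) auto

definition code_trans :: "instr list \<Rightarrow> nat \<Rightarrow> nat list \<Rightarrow> nat \<times> (nat \<times> move) list" where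
  "code_trans code q ss =
     (if q < length code
      then case code ! q of
             Do us \<Rightarrow> (q + 1, updates us ss)
           | Branch i C l \<Rightarrow> (if C (ss ! i) then l else q + 1, updates [] ss)
      else (q, updates [] ss))"

definition machine :: "nat \<Rightarrow> prog \<Rightarrow> turing_machine" where
  "machine K p = \<lparr>tapes = K, symbols = 4, states = code_size p + 1, halt_state = code_size p,
     trans = code_trans (compile p 0)\<rparr>"

lemma length_updates [simp]: "length (updates us ss) = length ss"
proof -
  have "length (fold (\<lambda>(i, g, d) as. as[i := (g ss, d)]) us as) = length as"
    for as :: "(nat \<times> move) list"
    by (induction us arbitrary: as) auto
  then show ?thesis by (simp add: updates_def)
qed

lemma map2_act_updates_Nil [simp]: "map2 act (updates [] (map scanned ts)) ts = ts"
proof (induction ts)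
  case (Cons t ts)
  then show ?case by (cases t) (simp add: updates_def)
qed (simp add: updates_def)

text \<open>Stated for a fragment inside arbitrary code, because the induction enters subprograms.
  It runs over \<open>exec\<close>, not over the program, since a loop recurs to itself.\<close>

lemma exec_compile:
  assumes "exec p ts t ts'" "code = xs @ compile p (length xs) @ ys"
    "trans M = code_trans code" "halt_state M = length code"
  shows "(step M ^^ t) (length xs, ts) = (length xs + code_size p, ts')"
  using assms(1,2)
proof (induction arbitrary: xs ys)
  case (Act us ts)
  then show ?case by (simp add: assms(3,4) code_trans_def nth_append apply_updates_def)
next
  case (Seq p ts t ts' q t' ts'')
  have "(step M ^^ t) (length xs, ts) = (length xs + code_size p, ts')"
    using Seq.prems by (intro Seq.IH(1)[of _ "compile q (length xs + code_size p) @ ys"]) simp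
  moreover have "(step M ^^ t') (length (xs @ compile p (length xs)), ts') =
      (length (xs @ compile p (length xs)) + code_size q, ts'')"
    using Seq.prems by (intro Seq.IH(2)[of _ ys]) simp
  ultimately show ?case by (simp add: funpow_add add.assoc)
next
  case (While_False C ts i p)
  then show ?case by (simp add: assms(3,4) code_trans_def nth_append)
next
  case (While_True C ts i p t ts' t' ts'')
  let ?b = "[Branch i (\<lambda>s. \<not> C s) (length xs + code_size p + 2)]"
  have 1: "step M (length xs, ts) = (length (xs @ ?b), ts)"
    using While_True.prems While_True.hyps(1) by (simp add: assms(3,4) code_trans_def nth_append)
  have 2: "(step M ^^ t) (length (xs @ ?b), ts) = (length (xs @ ?b) + code_size p, ts')"
    using While_True.prems by (intro While_True.IH(1)[of _ "Branch 0 (\<lambda>_. True) (length xs) # ys"]) simp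
  have 3: "step M (length (xs @ ?b) + code_size p, ts') = (length xs, ts')"
    using While_True.prems by (simp add: assms(3,4) code_trans_def nth_append)
  have 4: "(step M ^^ t') (length xs, ts') = (length xs + code_size (While i C p), ts'')"
    using While_True.prems by (intro While_True.IH(2)) simp
  have "(step M ^^ (t' + Suc (t + 1))) (length xs, ts) =
      (step M ^^ t') (step M ((step M ^^ t) (step M (length xs, ts))))"
    by (simp only: funpow_add funpow.simps o_apply One_nat_def id_apply)
  then show ?case using 1 2 3 4 by simp
next
  case (When_False C ts i p)
  then show ?case by (simp add: assms(3,4) code_trans_def nth_append)
next
  case (When_True C ts i p t ts')
  let ?b = "[Branch i (\<lambda>s. \<not> C s) (length xs + code_size p + 1)]"
  have 1: "step M (length xs, ts) = (length (xs @ ?b), ts)"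
    using When_True.prems When_True.hyps(1) by (simp add: assms(3,4) code_trans_def nth_append)
  have 2: "(step M ^^ t) (length (xs @ ?b), ts) = (length (xs @ ?b) + code_size p, ts')"
    using When_True.prems by (intro When_True.IH(1)[of _ ys]) simp
  have "(step M ^^ (t + 1)) (length xs, ts) = (step M ^^ t) (step M (length xs, ts))"
    by (simp only: funpow_add funpow.simps o_apply One_nat_def id_apply)
  then show ?case using 1 2 by simp
qed

corollary exec_machine:
  assumes "exec p (snd (initial_config (machine K p) x)) t ts"
  shows "run (machine K p) x t = (code_size p, ts)"
  using exec_compile[OF assms, of "compile p 0" "[]" "[]" "machine K p"]
  by (simp add: run_def machine_def initial_config_def)

text \<open>\<open>polynomial_time\<close> looks at one prescribed instant, so an earlier halt has
  to persist until then.\<close>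

lemma run_halted:
  assumes "halted M (run M x t)" "t \<le> t'"
  shows "run M x t' = run M x t"
proof -
  have "(step M ^^ j) (run M x t) = run M x t" for j
  proof (induction j)
    case (Suc j)
    then show ?case using assms(1) by (cases "run M x t") (simp add: halted_def)
  qed simp
  moreover have "run M x t' = (step M ^^ (t' - t)) (run M x t)"
    using assms(2) by (simp add: run_def funpow_add[symmetric, THEN fun_cong, simplified])
  ultimately show ?thesis by simp
qed

primrec wf_prog :: "nat \<Rightarrow> prog \<Rightarrow> bool" where
  "wf_prog K (Act us) \<longleftrightarrow> (\<forall>(i, g, d) \<in> set us. \<forall>ss. length ss = K \<and> set ss \<subseteq> {..<4} \<longrightarrow> g ss < 4)"
| "wf_prog K (p ;; q) \<longleftrightarrow> wf_prog K p \<and> wf_prog K q"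
| "wf_prog K (While i C p) \<longleftrightarrow> wf_prog K p"
| "wf_prog K (When i C p) \<longleftrightarrow> wf_prog K p"

lemma wf_compile:
  assumes "wf_prog K p" "c \<in> set (compile p a)"
  shows "case c of Do us \<Rightarrow> wf_prog K (Act us) | Branch i C l \<Rightarrow> l \<le> a + code_size p"
  using assms
proof (induction p arbitrary: a)
  case (Seq p q)
  then consider "c \<in> set (compile p a)" | "c \<in> set (compile q (a + code_size p))" by auto
  then show ?case
  proof cases
    case 1
    then show ?thesis using Seq.IH(1)[of a] Seq.prems by (auto split: instr.splits)
  next
    case 2
    then show ?thesis using Seq.IH(2)[of "a + code_size p"] Seq.prems by (auto split: instr.splits)
  qed
next
  case (While i C p)
  then show ?case using While.IH[of "a + 1"] by (cases c) auto
next
  case (When i C p)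
  then show ?case using When.IH[of "a + 1"] by (cases c) auto
qed simp

lemma symbols_updates:
  assumes "wf_prog K (Act us)" "length ss = K" "set ss \<subseteq> {..<4}"
  shows "fst ` set (updates us ss) \<subseteq> {..<4}"
proof -
  have "fst ` set (fold (\<lambda>(i, g, d) as. as[i := (g ss, d)]) us as) \<subseteq> {..<4}"
    if "fst ` set as \<subseteq> {..<4}" for as :: "(nat \<times> move) list"
    using that assms(1)
  proof (induction us arbitrary: as)
    case (Cons u us)
    obtain i g d where u: "u = (i, g, d)" by (cases u)
    have "g ss < 4" using Cons.prems(2) assms(2,3) by (simp add: u)
    then have "fst ` set (as[i := (g ss, d)]) \<subseteq> {..<4}"
      using Cons.prems(1) set_update_subset_insert[of as i "(g ss, d)"] by fastforce
    then show ?case using Cons by (simp add: u)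
  qed simp
  then show ?thesis using assms(3) by (auto simp: updates_def image_image)
qed

lemma wf_machine:
  assumes "wf_prog K p" "K \<ge> 1"
  shows "wf_turing_machine (machine K p)"
proof -
  have "case code_trans (compile p 0) q ss of (q', as) \<Rightarrow>
      q' < code_size p + 1 \<and> length as = K \<and> fst ` set as \<subseteq> {..<4}"
    if "q < code_size p + 1" "length ss = K" "set ss \<subseteq> {..<4}" for q ss
  proof (cases "q < code_size p")
    case True
    then have "compile p 0 ! q \<in> set (compile p 0)" by simp
    note wf = wf_compile[OF assms(1) this]
    show ?thesis
    proof (cases "compile p 0 ! q")
      case (Do us)
      then show ?thesis
        using True that wf symbols_updates[of K us ss] by (simp add: code_trans_def)
    next
      case (Branch i C l)
      then show ?thesis
        using True that wf symbols_updates[of K "[]" ss] by (simp add: code_trans_def)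
    qed
  next
    case False
    then show ?thesis using that symbols_updates[of K "[]" ss] by (simp add: code_trans_def)
  qed
  then show ?thesis using assms(2) by (simp add: wf_turing_machine_def machine_def)
qed

section \<open>Hoare triples with time bounds\<close>

definition triple :: "(tape list \<Rightarrow> bool) \<Rightarrow> prog \<Rightarrow> nat \<Rightarrow> (tape list \<Rightarrow> bool) \<Rightarrow> bool" where
  "triple P p b Q \<longleftrightarrow> (\<forall>ts. P ts \<longrightarrow> (\<exists>t ts'. t \<le> b \<and> exec p ts t ts' \<and> Q ts'))"

lemma triple_conseq:
  assumes "triple P p b Q" "\<And>ts. P' ts \<Longrightarrow> P ts" "b \<le> b'" "\<And>ts. Q ts \<Longrightarrow> Q' ts"
  shows "triple P' p b' Q'"
  using assms unfolding triple_def by (meson order_trans)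

lemma triple_Act: "(\<And>ts. P ts \<Longrightarrow> Q (apply_updates us ts)) \<Longrightarrow> triple P (Act us) 1 Q"
  unfolding triple_def using exec.Act by blast

lemma triple_Seq:
  assumes "triple P p b Q" "triple Q q b' R"
  shows "triple P (p ;; q) (b + b') R"
  unfolding triple_def
proof (intro allI impI)
  fix ts assume "P ts"
  then obtain t ts' where 1: "t \<le> b" "exec p ts t ts'" "Q ts'" using assms(1) unfolding triple_def
      by blast
  then obtain t' ts'' where "t' \<le> b'" "exec q ts' t' ts''" "R ts''" using assms(2)
      unfolding triple_def by blast
  with 1 show "\<exists>t ts''. t \<le> b + b' \<and> exec (p ;; q) ts t ts'' \<and> R ts''"
    by (intro exI[of _ "t' + t"] exI[of _ ts'']) (simp add: exec.Seq)
qed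

text \<open>The index of the invariant counts iterations and thus also proves termination. Each
  iteration adds a test and a jump to its body; the final 1 is the failing test.\<close>

lemma triple_While:
  assumes "\<And>j ts. j < k \<Longrightarrow> I j ts \<Longrightarrow> C (map scanned ts ! i)"
    and "\<And>j. j < k \<Longrightarrow> triple (I j) p b (I (Suc j))"
    and "\<And>ts. I k ts \<Longrightarrow> \<not> C (map scanned ts ! i)"
  shows "triple (I 0) (While i C p) (k * (b + 2) + 1) (I k)"
proof -
  have "triple (I j) (While i C p) ((k - j) * (b + 2) + 1) (I k)" if "j \<le> k" for j
    using that
  proof (induction rule: inc_induct)
    case base
    show ?case unfolding triple_def
    proof (intro allI impI)
      fix ts assume "I k ts"
      then show "\<exists>t ts'. t \<le> (k - k) * (b + 2) + 1 \<and> exec (While i C p) ts t ts' \<and> I k ts'"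
        using assms(3) exec.While_False[of C ts i p] by (intro exI[of _ 1] exI[of _ ts]) simp
    qed
  next
    case (step j)
    show ?case unfolding triple_def
    proof (intro allI impI)
      fix ts assume ts: "I j ts"
      then obtain t ts' where 1: "t \<le> b" "exec p ts t ts'" "I (Suc j) ts'"
        using assms(2)[OF \<open>j < k\<close>] unfolding triple_def by blast
      then obtain t' ts'' where 2: "t' \<le> (k - Suc j) * (b + 2) + 1" "exec (While i C p) ts' t' ts''"
          "I k ts''"
        using step.IH unfolding triple_def by blast
      have "exec (While i C p) ts (t' + Suc (t + 1)) ts''"
        using assms(1)[OF \<open>j < k\<close> ts] 1 2 by (intro exec.While_True)
      moreover have "k - j = Suc (k - Suc j)" using \<open>j < k\<close> by simp
      then have "t' + Suc (t + 1) \<le> (k - j) * (b + 2) + 1" using 1 2 by simp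
      ultimately show "\<exists>t ts'. t \<le> (k - j) * (b + 2) + 1 \<and> exec (While i C p) ts t ts' \<and> I k ts'"
        using 2(3) by blast
    qed
  qed
  from this[of 0] show ?thesis by simp
qed

abbreviation leads_to :: "tape list \<Rightarrow> prog \<Rightarrow> nat \<Rightarrow> tape list \<Rightarrow> bool" where
  "leads_to ts p b ts' \<equiv> triple (\<lambda>x. x = ts) p b (\<lambda>x. x = ts')"

lemma leads_to_Act: "apply_updates us ts = ts' \<Longrightarrow> leads_to ts (Act us) 1 ts'"
  by (rule triple_Act) simp

lemma leads_to_le: "leads_to ts p b ts' \<Longrightarrow> b \<le> b' \<Longrightarrow> leads_to ts p b' ts'"
  by (rule triple_conseq)

lemma leads_to_While:
  assumes "\<And>j. j < k \<Longrightarrow> C (map scanned (X j) ! i)"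
    and "\<And>j. j < k \<Longrightarrow> leads_to (X j) p b (X (Suc j))"
    and "\<not> C (map scanned (X k) ! i)"
    and "ts = X 0" "ts' = X k"
  shows "leads_to ts (While i C p) (k * (b + 2) + 1) ts'"
  unfolding assms(4,5)
  using triple_While[where I = "\<lambda>j x. x = X j" and i = i and C = C and k = k] assms(1-3) by auto

lemma leads_to_When_True:
  assumes "C (map scanned ts ! i)" "leads_to ts p b ts'"
  shows "leads_to ts (When i C p) (b + 1) ts'"
  using assms exec.When_True[of C ts i p] unfolding triple_def by (metis add_le_mono1)

lemma leads_to_When_False:
  assumes "\<not> C (map scanned ts ! i)"
  shows "leads_to ts (When i C p) 1 ts"
  using assms exec.When_False[of C ts i p] unfolding triple_def by blast

section \<open>A program that prints Mersenne primes\<close>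

fun move_by :: "move \<Rightarrow> int \<Rightarrow> int" where
  "move_by Left h = h - 1"
| "move_by Stay h = h"
| "move_by Right h = h + 1"

lemma act_eq: "act (s, d) (c, h) = (c(h := s), move_by d h)"
  by (cases d) auto

declare act.simps [simp del]

lemma apply_update:
  assumes "i < length ts"
  shows "apply_updates [(i, g, d)] ts = ts[i := act (g (map scanned ts), d) (ts ! i)]"
proof (rule nth_equalityI)
  show "length (apply_updates [(i, g, d)] ts) = length (ts[i := act (g (map scanned ts), d) (ts ! i)])"
    by (simp add: apply_updates_def)
next
  fix j assume "j < length (apply_updates [(i, g, d)] ts)"
  then have "j < length ts" by (simp add: apply_updates_def)
  then show "apply_updates [(i, g, d)] ts ! j = ts[i := act (g (map scanned ts), d) (ts ! i)] ! j"
    using assms by (cases "ts ! j") (auto simp: apply_updates_def updates_def nth_list_update act_eq)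
qed

text \<open>A block of symbols as a function with a length: overwriting is function update, while
  appending and erasing at the right end change \<open>k\<close>.\<close>

definition cells :: "nat \<Rightarrow> (nat \<Rightarrow> nat) \<Rightarrow> int \<Rightarrow> nat" where
  "cells k F i = (if 0 \<le> i \<and> nat i < k then F (nat i) else blank)"

lemma cells_cong: "(\<And>i. i < k \<Longrightarrow> F i = G i) \<Longrightarrow> cells k F = cells k G"
  by (auto simp: fun_eq_iff cells_def)

lemma written_eq_cells: "written w = cells (length w) ((!) w)"
  by (auto simp: fun_eq_iff written_def cells_def)

lemma cells_snoc: "(cells k F)(int k := x) = cells (Suc k) (F(k := x))"
  by (auto simp: fun_eq_iff cells_def)

lemma cells_butlast: "(cells (Suc k) F)(int k := blank) = cells k F"
  by (auto simp: fun_eq_iff cells_def)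

lemma written_snoc: "(written w)(int (length w) := x) = written (w @ [x])"
  by (auto simp: fun_eq_iff written_def nth_append)

section \<open>Basic head movements\<close>

definition go :: "nat \<Rightarrow> move \<Rightarrow> prog" where
  "go i d = Act [(i, \<lambda>ss. ss ! i, d)]"

definition put :: "nat \<Rightarrow> nat \<Rightarrow> move \<Rightarrow> prog" where
  "put i x d = Act [(i, \<lambda>_. x, d)]"

text \<open>Made for a head on the blank behind the word: the first move enters the word, the last
  one steps back from the blank at position -1.\<close>

definition to_start :: "nat \<Rightarrow> prog" where
  "to_start i = go i Left ;; While i (\<lambda>s. s \<noteq> blank) (go i Left) ;; go i Right"

definition to_end :: "nat \<Rightarrow> prog" where
  "to_end i = While i (\<lambda>s. s \<noteq> blank) (go i Right)"

text \<open>The head may stand inside the word, for example where the search for a zero bit stopped,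
  so erasing begins at the right end.\<close>

definition clear :: "nat \<Rightarrow> prog" where
  "clear i = to_end i ;; go i Left ;; While i (\<lambda>s. s \<noteq> blank) (put i blank Left) ;; go i Right"

lemma leads_to_go:
  assumes "i < length ts" "ts ! i = (c, h)"
  shows "leads_to ts (go i d) 1 (ts[i := (c, move_by d h)])"
  unfolding go_def using assms by (intro leads_to_Act) (simp add: apply_update act_eq)

lemma leads_to_put:
  assumes "i < length ts" "ts ! i = (c, h)"
  shows "leads_to ts (put i x d) 1 (ts[i := (c(h := x), move_by d h)])"
  unfolding put_def using assms by (intro leads_to_Act) (simp add: apply_update act_eq)

lemma leads_to_to_start:
  assumes "i < length ts" "ts ! i = (cells k F, int k)" "\<And>j. j < k \<Longrightarrow> F j \<noteq> blank"
  shows "leads_to ts (to_start i) (3 * k + 3) (ts[i := (cells k F, 0)])"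
proof -
  let ?X = "\<lambda>j. ts[i := (cells k F, int k - 1 - int j)]"
  have "leads_to ts (go i Left) 1 (?X 0)"
    using leads_to_go[OF assms(1,2), of Left] by simp
  moreover have "leads_to (?X 0) (While i (\<lambda>s. s \<noteq> blank) (go i Left)) (k * (1 + 2) + 1) (?X k)"
  proof (rule leads_to_While[where X = ?X])
    fix j assume "j < k"
    then show "map scanned (?X j) ! i \<noteq> blank"
      using assms(1,3) by (simp add: cells_def nat_diff_distrib')
    show "leads_to (?X j) (go i Left) 1 (?X (Suc j))"
      using leads_to_go[of i "?X j" "cells k F" "int k - 1 - int j" Left] assms(1)
          by (simp add: algebra_simps)
  qed (use assms(1) in \<open>simp_all add: cells_def\<close>)
  moreover have "leads_to (?X k) (go i Right) 1 (ts[i := (cells k F, 0)])"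
    using leads_to_go[of i "?X k" "cells k F" _ Right] assms(1) by simp
  ultimately have "leads_to ts (to_start i) (1 + ((k * (1 + 2) + 1) + 1)) (ts[i := (cells k F, 0)])"
    unfolding to_start_def by (intro triple_Seq)
  then show ?thesis by (rule leads_to_le) simp
qed

lemma leads_to_to_end:
  assumes "i < length ts" "ts ! i = (cells k F, int h)" "h \<le> k" "\<And>j. j < k \<Longrightarrow> F j \<noteq> blank"
  shows "leads_to ts (to_end i) (3 * k + 1) (ts[i := (cells k F, int k)])"
proof -
  let ?X = "\<lambda>j. ts[i := (cells k F, int h + int j)]"
  have "leads_to ts (to_end i) ((k - h) * (1 + 2) + 1) (ts[i := (cells k F, int k)])"
    unfolding to_end_def
  proof (rule leads_to_While[where X = ?X])
    fix j assume "j < k - h"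
    then show "map scanned (?X j) ! i \<noteq> blank"
      using assms(1,4) by (simp add: cells_def nat_add_distrib)
    show "leads_to (?X j) (go i Right) 1 (?X (Suc j))"
      using leads_to_go[of i "?X j" "cells k F" "int h + int j" Right] assms(1)
          by (simp add: algebra_simps)
  qed (use assms list_update_id[of ts i] in \<open>simp_all add: cells_def of_nat_diff\<close>)
  then show ?thesis by (rule leads_to_le) simp
qed

lemma leads_to_clear:
  assumes "i < length ts" "ts ! i = (cells k F, int h)" "h \<le> k" "\<And>j. j < k \<Longrightarrow> F j \<noteq> blank"
  shows "leads_to ts (clear i) (6 * k + 4) (ts[i := (cells 0 (\<lambda>_. blank), 0)])"
proof -
  let ?X = "\<lambda>j. ts[i := (cells (k - j) F, int k - 1 - int j)]"
  have "leads_to ts (to_end i) (3 * k + 1) (ts[i := (cells k F, int k)])"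
    by (rule leads_to_to_end[OF assms])
  moreover have "leads_to (ts[i := (cells k F, int k)]) (go i Left) 1 (?X 0)"
    using leads_to_go[of i "ts[i := (cells k F, int k)]" "cells k F" _ Left] assms(1) by simp
  moreover have "leads_to (?X 0) (While i (\<lambda>s. s \<noteq> blank) (put i blank Left)) (k * (1 + 2) + 1) (?X k)"
  proof (rule leads_to_While[where X = ?X])
    fix j assume j: "j < k"
    then show "map scanned (?X j) ! i \<noteq> blank"
      using assms(1,4) by (simp add: cells_def nat_diff_distrib')
    have "k - j = Suc (k - Suc j)" "int k - 1 - int j = int (k - Suc j)" using j by auto
    then have "(cells (k - j) F)(int k - 1 - int j := blank) = cells (k - Suc j) F"
      by (simp only: cells_butlast)
    then show "leads_to (?X j) (put i blank Left) 1 (?X (Suc j))"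
      using leads_to_put[of i "?X j" "cells (k - j) F" "int k - 1 - int j" blank Left] assms(1)
          by (simp add: algebra_simps)
  qed (use assms(1) in \<open>simp_all add: cells_def\<close>)
  moreover have "leads_to (?X k) (go i Right) 1 (ts[i := (cells 0 (\<lambda>_. blank), 0)])"
    using leads_to_go[of i "?X k" "cells 0 F" _ Right] assms(1) cells_cong[of 0 F "\<lambda>_. blank"] by simp
  ultimately have "leads_to ts (clear i) ((3 * k + 1) + (1 + ((k * (1 + 2) + 1) + 1)))
      (ts[i := (cells 0 (\<lambda>_. blank), 0)])"
    unfolding clear_def by (intro triple_Seq)
  then show ?thesis by (rule leads_to_le) simp
qed

text \<open>Tape 0 holds the input, which is shortened from the right; its length is the exponent under
  test. Tapes 1, 2 and 3 hold the multiplier, the accumulator and the multiplicand, least significant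
  bit first. Tapes 4 and 5 are used as registers of one cell: the pending carry and the bit that
  enters the multiplicand when it is rotated. Tape 6 is the output.\<close>

abbreviation register :: "nat \<Rightarrow> tape" where
  "register s \<equiv> ((\<lambda>_. blank)(0 := s), 0)"

abbreviation conf where
  "conf U S A B c r W \<equiv> [U, S, A, B, register c, register r, W]"

abbreviation word :: "nat \<Rightarrow> (nat \<Rightarrow> bool) \<Rightarrow> int \<Rightarrow> nat" where
  "word k a \<equiv> cells k (\<lambda>i. bit_symbol (a i))"

lemma bit_symbol_simps [simp]:
  "bit_symbol b \<noteq> blank" "bit_symbol b = 2 \<longleftrightarrow> b" "bit_symbol b < 4" "blank < 4" "blank \<noteq> 2"
  by (auto simp: bit_symbol_def blank_def)

lemma word_upd: "j < k \<Longrightarrow> (word k a)(int j := bit_symbol x) = word k (a(j := x))"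
  by (auto simp: fun_eq_iff cells_def)

text \<open>One column of a full adder. Tape 5 is a one-cell delay line that moves the multiplicand
  up by one position, so adding and doubling share a pass.\<close>

definition add_step :: "update list" where
  "add_step =
     [(2, \<lambda>ss. bit_symbol ((ss ! 2 = 2) \<noteq> ((ss ! 1 = 2 \<and> ss ! 3 = 2) \<noteq> (ss ! 4 = 2))), Right),
      (3, \<lambda>ss. ss ! 5, Right),
      (4, \<lambda>ss. bit_symbol (if ss ! 2 = 2 then (ss ! 1 = 2 \<and> ss ! 3 = 2) \<or> ss ! 4 = 2
                           else (ss ! 1 = 2 \<and> ss ! 3 = 2) \<and> ss ! 4 = 2), Stay),
      (5, \<lambda>ss. ss ! 3, Stay)]"

definition add_pass :: prog where
  "add_pass = While 2 (\<lambda>s. s \<noteq> blank) (Act add_step)"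

lemma leads_to_add_pass:
  fixes b :: "nat \<Rightarrow> bool"
  assumes "scanned S = 2 \<longleftrightarrow> x"
  defines "b' \<equiv> \<lambda>i. x \<and> b i"
  shows "leads_to (conf U S (word k a, 0) (word k b, 0) (bit_symbol c) (bit_symbol r) W) add_pass
      (3 * k + 1)
     (conf U S (word k (sum_bits a b' c), int k) (word k (shift r b), int k)
        (bit_symbol (carries a b' c k)) (bit_symbol (shift r b k)) W)"
proof -
  let ?X = "\<lambda>j. conf U S (word k (\<lambda>i. if i < j then sum_bits a b' c i else a i), int j)
      (word k (\<lambda>i. if i < j then shift r b i else b i), int j)
      (bit_symbol (carries a b' c j)) (bit_symbol (shift r b j)) W"
  have "leads_to (conf U S (word k a, 0) (word k b, 0) (bit_symbol c) (bit_symbol r) W) add_pass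
      (k * (1 + 2) + 1)
     (conf U S (word k (sum_bits a b' c), int k) (word k (shift r b), int k)
        (bit_symbol (carries a b' c k)) (bit_symbol (shift r b k)) W)"
    unfolding add_pass_def
  proof (rule leads_to_While[where X = ?X])
    fix j assume j: "j < k"
    then show "map scanned (?X j) ! 2 \<noteq> blank" by (simp add: cells_def)
    have upd: "(\<lambda>i. if i < j then F i else G i)(j := F j) = (\<lambda>i. if i < Suc j then F i else G i)"
      for F G :: "nat \<Rightarrow> bool" by (auto simp: fun_eq_iff less_Suc_eq)
    have scan: "word k e (int j) = bit_symbol (e j)" for e using j by (simp add: cells_def)
    show "leads_to (?X j) (Act add_step) 1 (?X (Suc j))"
      by (rule leads_to_Act)
        (cases U; cases S; cases W; use assms(1) j in \<open>simp add: apply_updates_def updates_def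
            add_step_def act_eq scan
          word_upd upd b'_def, auto intro!: cells_cong simp: sum_bits_def b'_def less_Suc_eq\<close>)
  qed (auto simp: cells_def intro!: cells_cong)
  then show ?thesis by (rule leads_to_le) simp
qed

lemma leads_to_eq: "leads_to ts p b ts' \<Longrightarrow> ts' = ts'' \<Longrightarrow> leads_to ts p b ts''"
  by simp

text \<open>After a pass tape 5 holds the old top bit, which has already re-entered at position 0.
  The next rotation needs the top bit of the rotated word.\<close>

definition reload :: prog where
  "reload = go 3 Left ;; Act [(5, \<lambda>ss. ss ! 3, Stay), (3, \<lambda>ss. ss ! 3, Right)] ;; to_start 3"

lemma leads_to_reload:
  assumes "k > 0"
  shows "leads_to (conf U S A (word k b, int k) c r W) reload (3 * k + 5)
    (conf U S A (word k b, 0) c (bit_symbol (b (k - 1))) W)"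
proof -
  have upd: "(word k b)(int k - 1 := bit_symbol (b (k - 1))) = word k b"
    "word k b (int k - 1) = bit_symbol (b (k - 1))"
    using assms by (auto simp: fun_eq_iff cells_def nat_diff_distrib')
  have "leads_to (conf U S A (word k b, int k) c r W) (go 3 Left) 1
      (conf U S A (word k b, int k - 1) c r W)"
    using leads_to_go[of 3 "conf U S A (word k b, int k) c r W" _ _ Left] by simp
  moreover have "leads_to (conf U S A (word k b, int k - 1) c r W)
      (Act [(5, \<lambda>ss. ss ! 3, Stay), (3, \<lambda>ss. ss ! 3, Right)]) 1
      (conf U S A (word k b, int k) c (bit_symbol (b (k - 1))) W)"
    by (rule leads_to_Act)
      (cases U; cases S; cases A; cases W; simp add: apply_updates_def updates_def act_eq upd
          upd[unfolded One_nat_def])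
  moreover have "leads_to (conf U S A (word k b, int k) c (bit_symbol (b (k - 1))) W) (to_start 3)
      (3 * k + 3) (conf U S A (word k b, 0) c (bit_symbol (b (k - 1))) W)"
    using leads_to_to_start[of 3 "conf U S A (word k b, int k) c (bit_symbol (b (k - 1))) W"] by simp
  ultimately have "leads_to (conf U S A (word k b, int k) c r W) reload (1 + (1 + (3 * k + 3)))
      (conf U S A (word k b, 0) c (bit_symbol (b (k - 1))) W)"
    unfolding reload_def by (intro triple_Seq)
  then show ?thesis by (rule leads_to_le) simp
qed

fun mult_conf :: "nat \<Rightarrow> tape \<Rightarrow> tape \<Rightarrow> (nat \<Rightarrow> bool) \<times> (nat \<Rightarrow> bool) \<times> bool \<Rightarrow> tape \<Rightarrow> tape list" where
  "mult_conf k U S (a, b, c) W =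
     conf U S (word k a, 0) (word k b, 0) (bit_symbol c) (bit_symbol (b (k - 1))) W"

definition mult_round_prog :: prog where
  "mult_round_prog = add_pass ;; reload ;; to_start 2"

lemma leads_to_mult_round:
  assumes "k > 0" "scanned S = 2 \<longleftrightarrow> x"
  shows "leads_to (mult_conf k U S s W) mult_round_prog (9 * k + 9)
      (mult_conf k U S (mult_round k x s) W)"
proof -
  obtain a b c where s: "s = (a, b, c)" by (cases s)
  let ?r = "b (k - 1)" let ?b = "\<lambda>i. x \<and> b i"
  let ?a' = "sum_bits a ?b c" let ?b' = "shift ?r b" let ?c' = "carries a ?b c k"
  let ?X = "\<lambda>h r. conf U S (word k ?a', h) (word k ?b', 0) (bit_symbol ?c') r W"
  have "leads_to (mult_conf k U S s W) add_pass (3 * k + 1)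
      (conf U S (word k ?a', int k) (word k ?b', int k) (bit_symbol ?c') (bit_symbol (?b' k)) W)"
    using leads_to_add_pass[OF assms(2)] by (simp add: s)
  moreover have "leads_to (conf U S (word k ?a', int k) (word k ?b', int k) (bit_symbol ?c')
      (bit_symbol (?b' k)) W)
      reload (3 * k + 5) (?X (int k) (bit_symbol (?b' (k - 1))))"
    by (rule leads_to_reload[OF assms(1)])
  moreover have "leads_to (?X (int k) (bit_symbol (?b' (k - 1)))) (to_start 2) (3 * k + 3)
      (mult_conf k U S (mult_round k x s) W)"
    using leads_to_to_start[of 2 "?X (int k) (bit_symbol (?b' (k - 1)))"] by (simp add: s)
  ultimately have "leads_to (mult_conf k U S s W) mult_round_prog
      (3 * k + 1 + (3 * k + 5 + (3 * k + 3)))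
      (mult_conf k U S (mult_round k x s) W)"
    unfolding mult_round_prog_def by (intro triple_Seq)
  then show ?thesis by (rule leads_to_le) simp
qed

text \<open>For squaring, the previous result becomes multiplier and multiplicand. Ones with a zero
  at position 1 form the word of 2^k - 3, which supplies the -2 of the recurrence.\<close>

definition transfer :: prog where
  "transfer =
     While 2 (\<lambda>s. s \<noteq> blank)
       (Act [(1, \<lambda>ss. ss ! 2, Right), (2, \<lambda>_. bit_symbol True, Right), (3, \<lambda>ss. ss ! 2, Right)]) ;;
     to_start 1 ;; to_start 2 ;; reload ;;
     go 2 Right ;; put 2 (bit_symbol False) Left ;; put 4 (bit_symbol False) Stay"

lemma leads_to_transfer:
  assumes "k \<ge> 2"
  shows "leads_to (conf U (word k s, 0) (word k a, 0) (word k b, 0) c r W) transfer (12 * k + 15)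
    (mult_conf k U (word k a, 0) (\<lambda>i. i \<noteq> 1, a, False) W)"
proof -
  let ?X = "\<lambda>j. conf U (word k (\<lambda>i. if i < j then a i else s i), int j)
      (word k (\<lambda>i. i < j \<or> a i), int j) (word k (\<lambda>i. if i < j then a i else b i), int j) c r W"
  let ?one = "\<lambda>i :: nat. True"
  let ?r = "bit_symbol (a (k - 1))"
  let ?Y = "\<lambda>hs ha. conf U (word k a, hs) (word k ?one, ha) (word k a, int k) c r W"
  let ?Z = "\<lambda>a' ha. conf U (word k a, 0) (word k a', ha) (word k a, 0) c ?r W"
  have "leads_to (conf U (word k s, 0) (word k a, 0) (word k b, 0) c r W)
      (While 2 (\<lambda>s. s \<noteq> blank)
       (Act [(1, \<lambda>ss. ss ! 2, Right), (2, \<lambda>_. bit_symbol True, Right), (3, \<lambda>ss. ss ! 2, Right)]))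
      (k * (1 + 2) + 1) (?Y (int k) (int k))"
  proof (rule leads_to_While[where X = ?X])
    fix j assume j: "j < k"
    then show "map scanned (?X j) ! 2 \<noteq> blank" by (simp add: cells_def)
    have upd: "(\<lambda>i. if i < j then F i else G i)(j := F j) = (\<lambda>i. if i < Suc j then F i else G i)"
      "(\<lambda>i. i < j \<or> F i)(j := True) = (\<lambda>i. i < Suc j \<or> F i)"
      for F G :: "nat \<Rightarrow> bool" by (auto simp: fun_eq_iff less_Suc_eq)
    have scan: "word k e (int j) = bit_symbol (e j)" for e using j by (simp add: cells_def)
    show "leads_to (?X j) (Act [(1, \<lambda>ss. ss ! 2, Right), (2, \<lambda>_. bit_symbol True, Right),
        (3, \<lambda>ss. ss ! 2, Right)]) 1 (?X (Suc j))"
      by (rule leads_to_Act)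
        (cases U; cases W; use j in \<open>simp add: apply_updates_def updates_def act_eq scan word_upd upd\<close>)
  qed (auto simp: cells_def intro!: cells_cong)
  moreover have "leads_to (?Y (int k) (int k)) (to_start 1) (3 * k + 3) (?Y 0 (int k))"
    using leads_to_to_start[of 1 "?Y (int k) (int k)"] by simp
  moreover have "leads_to (?Y 0 (int k)) (to_start 2) (3 * k + 3) (?Y 0 0)"
    using leads_to_to_start[of 2 "?Y 0 (int k)"] by simp
  moreover have "leads_to (?Y 0 0) reload (3 * k + 5) (?Z ?one 0)"
    using assms by (intro leads_to_reload) simp
  moreover have "leads_to (?Z ?one 0) (go 2 Right) 1 (?Z ?one 1)"
    using leads_to_go[of 2 "?Z ?one 0" _ _ Right] by simp
  moreover have "leads_to (?Z ?one 1) (put 2 (bit_symbol False) Left) 1 (?Z (\<lambda>i. i \<noteq> 1) 0)"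
  proof -
    have "(word k ?one)(int 1 := bit_symbol False) = word k (?one(1 := False))"
      using assms by (intro word_upd) simp
    also have "?one(1 := False) = (\<lambda>i. i \<noteq> 1)" by auto
    finally have "(word k ?one)(1 := bit_symbol False) = word k (\<lambda>i. i \<noteq> 1)"
      unfolding of_nat_1 .
    then show ?thesis by (intro leads_to_put[of 2 "?Z ?one 1" _ _ "bit_symbol False" Left, THEN
        leads_to_eq]) simp_all
  qed
  moreover have "leads_to (?Z (\<lambda>i. i \<noteq> 1) 0) (put 4 (bit_symbol False) Stay) 1
      (mult_conf k U (word k a, 0) (\<lambda>i. i \<noteq> 1, a, False) W)"
    using leads_to_put[of 4 "?Z (\<lambda>i. i \<noteq> 1) 0" _ _ "bit_symbol False" Stay] by simp
  ultimately have "leads_to (conf U (word k s, 0) (word k a, 0) (word k b, 0) c r W) transfer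
      ((k * (1 + 2) + 1) + ((3 * k + 3) + ((3 * k + 3) + ((3 * k + 5) + (1 + (1 + 1))))))
      (mult_conf k U (word k a, 0) (\<lambda>i. i \<noteq> 1, a, False) W)"
    unfolding transfer_def by (intro triple_Seq)
  then show ?thesis by (rule leads_to_le) simp
qed

text \<open>After the loop the head of tape 1 scans a blank, which \<open>add_pass\<close> treats as the bit 0.\<close>

definition square_prog :: prog where
  "square_prog =
     transfer ;; While 1 (\<lambda>s. s \<noteq> blank) (mult_round_prog ;; go 1 Right) ;;
     mult_round_prog ;; mult_round_prog ;; to_start 1"

lemma mult_conf_list_update_1: "(mult_conf k U S s W)[Suc 0 := S'] = mult_conf k U S' s W"
  by (cases s) simp

lemma mult_conf_nth_1: "mult_conf k U S s W ! Suc 0 = S"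
  by (cases s) simp

lemma length_mult_conf: "length (mult_conf k U S s W) = 7"
  by (cases s) simp

lemma leads_to_square:
  assumes "k \<ge> 2"
  shows "leads_to (conf U (word k s, 0) (word k a, 0) (word k b, 0) c r W) square_prog
    (9 * k * k + 45 * k + 37) (mult_conf k U (word k a, 0) (square_rounds k a) W)"
proof -
  let ?X = "\<lambda>j. mult_conf k U (word k a, int j) (mult_rounds k a j) W"
  let ?Y = "\<lambda>s. mult_conf k U (word k a, int k) s W"
  have k: "k > 0" using assms by simp
  have blank: "scanned (word k a, int k) = 2 \<longleftrightarrow> False" by (simp add: cells_def)
  have "leads_to (conf U (word k s, 0) (word k a, 0) (word k b, 0) c r W) transfer (12 * k + 15) (?X 0)"
    using leads_to_transfer[OF assms] by simp
  moreover have "leads_to (?X 0) (While 1 (\<lambda>s. s \<noteq> blank) (mult_round_prog ;; go 1 Right))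
      (k * (9 * k + 9 + 1 + 2) + 1) (?X k)"
  proof (rule leads_to_While[where X = ?X])
    fix j assume j: "j < k"
    then show "map scanned (?X j) ! 1 \<noteq> blank" by (simp add: length_mult_conf mult_conf_nth_1 cells_def)
    let ?Z = "mult_conf k U (word k a, int j) (mult_rounds k a (Suc j)) W"
    have "leads_to (?X j) mult_round_prog (9 * k + 9) ?Z"
      using leads_to_mult_round[OF k, of "(word k a, int j)" "a j"] j by (simp add: cells_def)
    moreover have "leads_to ?Z (go 1 Right) 1 (?X (Suc j))"
      using leads_to_go[of 1 ?Z _ _ Right]
      by (simp add: length_mult_conf mult_conf_nth_1 mult_conf_list_update_1 add.commute del:
          mult_rounds.simps)
    ultimately show "leads_to (?X j) (mult_round_prog ;; go 1 Right) (9 * k + 9 + 1) (?X (Suc j))"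
      by (rule triple_Seq)
  qed (simp_all add: length_mult_conf mult_conf_nth_1 cells_def)
  moreover have "leads_to (?X k) mult_round_prog (9 * k + 9)
      (?Y (mult_round k False (mult_rounds k a k)))"
    "leads_to (?Y (mult_round k False (mult_rounds k a k))) mult_round_prog (9 * k + 9)
        (?Y (square_rounds k a))"
    unfolding square_rounds_def by (rule leads_to_mult_round[OF k blank])+
  moreover have "leads_to (?Y (square_rounds k a)) (to_start 1) (3 * k + 3)
      (mult_conf k U (word k a, 0) (square_rounds k a) W)"
    using leads_to_to_start[of 1 "?Y (square_rounds k a)" k]
    by (simp add: length_mult_conf mult_conf_nth_1 mult_conf_list_update_1)
  ultimately have "leads_to (conf U (word k s, 0) (word k a, 0) (word k b, 0) c r W) square_prog
      ((12 * k + 15) + ((k * (9 * k + 9 + 1 + 2) + 1) + ((9 * k + 9) + ((9 * k + 9) + (3 * k + 3)))))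
      (mult_conf k U (word k a, 0) (square_rounds k a) W)"
    unfolding square_prog_def by (intro triple_Seq)
  then show ?thesis by (rule leads_to_le) (simp add: algebra_simps)
qed

text \<open>The input serves as a unary counter: one walk over it lays out words of length
  \<open>k\<close>. The one at position 2 is the start value 4. Leaving the head of tape 0 on cell 2
  puts \<open>k - 2\<close> cells ahead, the number of Lucas--Lehmer iterations.\<close>

definition init_prog :: prog where
  "init_prog =
     While 0 (\<lambda>s. s \<noteq> blank)
       (Act [(0, \<lambda>ss. ss ! 0, Left), (1, \<lambda>_. bit_symbol False, Right),
             (2, \<lambda>_. bit_symbol False, Right), (3, \<lambda>_. bit_symbol False, Right)]) ;;
     to_start 1 ;; to_start 2 ;; to_start 3 ;;
     go 2 Right ;; go 2 Right ;; put 2 (bit_symbol True) Left ;; go 2 Left ;;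
     go 0 Right ;; go 0 Right ;; go 0 Right"

abbreviation empty_tape :: tape where
  "empty_tape \<equiv> (cells 0 (\<lambda>_. blank), 0)"

lemma leads_to_init:
  assumes k: "k \<ge> 3" and F: "\<And>i. i < k \<Longrightarrow> F i \<noteq> blank"
  shows "leads_to (conf (cells k F, int k - 1) empty_tape empty_tape empty_tape c r W) init_prog
      (12 * k + 17)
    (conf (cells k F, 2) (word k (\<lambda>_. False), 0) (word k (\<lambda>i. i = 2), 0) (word k (\<lambda>_. False), 0) c r W)"
proof -
  let ?zero = "\<lambda>i :: nat. False"
  let ?X = "\<lambda>j. conf (cells k F, int k - 1 - int j) (word j ?zero, int j) (word j ?zero, int j)
      (word j ?zero, int j) c r W"
  let ?Y = "\<lambda>hu hs a ha hb. conf (cells k F, hu) (word k ?zero, hs) (word k a, ha)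
      (word k ?zero, hb) c r W"
  have "leads_to (conf (cells k F, int k - 1) empty_tape empty_tape empty_tape c r W)
     (While 0 (\<lambda>s. s \<noteq> blank)
       (Act [(0, \<lambda>ss. ss ! 0, Left), (1, \<lambda>_. bit_symbol False, Right),
             (2, \<lambda>_. bit_symbol False, Right), (3, \<lambda>_. bit_symbol False, Right)])) (k * (1 + 2) + 1)
     (?Y (- 1) (int k) ?zero (int k) (int k))"
  proof (rule leads_to_While[where X = ?X])
    fix j assume j: "j < k"
    then have h: "0 \<le> int k - 1 - int j" "nat (int k - 1 - int j) = k - Suc j"
      "int k - 1 - int j - 1 = int k - 1 - int (Suc j)" by auto
    show "map scanned (?X j) ! 0 \<noteq> blank" using F[of "k - Suc j"] j h by (simp add: cells_def)
    have zero: "(word j ?zero)(int j := bit_symbol False) = word (Suc j) ?zero"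
      unfolding cells_snoc by (rule cells_cong) simp
    show "leads_to (?X j) (Act [(0, \<lambda>ss. ss ! 0, Left), (1, \<lambda>_. bit_symbol False, Right),
             (2, \<lambda>_. bit_symbol False, Right), (3, \<lambda>_. bit_symbol False, Right)]) 1 (?X (Suc j))"
      by (rule leads_to_Act) (cases W; simp add: apply_updates_def updates_def act_eq zero)
  qed (auto simp: cells_def intro!: cells_cong)
  moreover have "leads_to (?Y (- 1) (int k) ?zero (int k) (int k)) (to_start 1) (3 * k + 3)
      (?Y (- 1) 0 ?zero (int k) (int k))"
    using leads_to_to_start[of 1 "?Y (- 1) (int k) ?zero (int k) (int k)" k] by simp
  moreover have "leads_to (?Y (- 1) 0 ?zero (int k) (int k)) (to_start 2) (3 * k + 3)
      (?Y (- 1) 0 ?zero 0 (int k))"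
    using leads_to_to_start[of 2 "?Y (- 1) 0 ?zero (int k) (int k)" k] by simp
  moreover have "leads_to (?Y (- 1) 0 ?zero 0 (int k)) (to_start 3) (3 * k + 3) (?Y (- 1) 0 ?zero 0 0)"
    using leads_to_to_start[of 3 "?Y (- 1) 0 ?zero 0 (int k)" k] by simp
  moreover have "leads_to (?Y (- 1) 0 ?zero 0 0) (go 2 Right) 1 (?Y (- 1) 0 ?zero 1 0)"
    using leads_to_go[of 2 "?Y (- 1) 0 ?zero 0 0" _ _ Right] by simp
  moreover have "leads_to (?Y (- 1) 0 ?zero 1 0) (go 2 Right) 1 (?Y (- 1) 0 ?zero 2 0)"
    using leads_to_go[of 2 "?Y (- 1) 0 ?zero 1 0" _ _ Right] by simp
  moreover have "leads_to (?Y (- 1) 0 ?zero 2 0) (put 2 (bit_symbol True) Left) 1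
      (?Y (- 1) 0 (\<lambda>i. i = 2) 1 0)"
  proof -
    have "(word k ?zero)(int 2 := bit_symbol True) = word k (?zero(2 := True))"
      using k by (intro word_upd) simp
    also have "?zero(2 := True) = (\<lambda>i. i = 2)" by (auto simp: fun_eq_iff)
    finally have "(word k ?zero)(2 := bit_symbol True) = word k (\<lambda>i. i = 2)"
      unfolding of_nat_numeral .
    then show ?thesis by (intro leads_to_put[of 2 "?Y (- 1) 0 ?zero 2 0" _ _ "bit_symbol True" Left,
        THEN leads_to_eq]) simp_all
  qed
  moreover have "leads_to (?Y (- 1) 0 (\<lambda>i. i = 2) 1 0) (go 2 Left) 1 (?Y (- 1) 0 (\<lambda>i. i = 2) 0 0)"
    using leads_to_go[of 2 "?Y (- 1) 0 (\<lambda>i. i = 2) 1 0" _ _ Left] by simp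
  moreover have "leads_to (?Y (- 1) 0 (\<lambda>i. i = 2) 0 0) (go 0 Right) 1 (?Y 0 0 (\<lambda>i. i = 2) 0 0)"
    using leads_to_go[of 0 "?Y (- 1) 0 (\<lambda>i. i = 2) 0 0" _ _ Right] by simp
  moreover have "leads_to (?Y 0 0 (\<lambda>i. i = 2) 0 0) (go 0 Right) 1 (?Y 1 0 (\<lambda>i. i = 2) 0 0)"
    using leads_to_go[of 0 "?Y 0 0 (\<lambda>i. i = 2) 0 0" _ _ Right] by simp
  moreover have "leads_to (?Y 1 0 (\<lambda>i. i = 2) 0 0) (go 0 Right) 1 (?Y 2 0 (\<lambda>i. i = 2) 0 0)"
    using leads_to_go[of 0 "?Y 1 0 (\<lambda>i. i = 2) 0 0" _ _ Right] by simp
  ultimately have "leads_to (conf (cells k F, int k - 1) empty_tape empty_tape empty_tape c r W)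
      init_prog
      ((k * (1 + 2) + 1) + ((3 * k + 3) + ((3 * k + 3) +
          ((3 * k + 3) + (1 + (1 + (1 + (1 + (1 + (1 + 1))))))))))
      (?Y 2 0 (\<lambda>i. i = 2) 0 0)"
    unfolding init_prog_def by (intro triple_Seq)
  then show ?thesis by (rule leads_to_le) simp
qed

definition lucas_lehmer_prog :: prog where
  "lucas_lehmer_prog = While 0 (\<lambda>s. s \<noteq> blank) (square_prog ;; go 0 Right)"

text \<open>Only the counter and the accumulator are tracked; the quantified parts hold whatever the
  last squaring left behind.\<close>

lemma triple_lucas_lehmer:
  fixes W :: tape
  assumes k: "k \<ge> 3" and F: "\<And>i. i < k \<Longrightarrow> F i \<noteq> blank"
  defines "I \<equiv> \<lambda>j ts. \<exists>s b c r. ts = conf (cells k F, int j + 2) (word k s, 0)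
      (word k (lucas_lehmer_bits k j), 0) (word k b, 0) c r W"
  shows "triple (I 0) lucas_lehmer_prog (k * (9 * k * k + 45 * k + 40) + 1) (I (k - 2))"
proof -
  have "triple (I 0) lucas_lehmer_prog ((k - 2) * (9 * k * k + 45 * k + 37 + 1 + 2) + 1) (I (k - 2))"
    unfolding lucas_lehmer_prog_def
  proof (rule triple_While)
    fix j ts assume "j < k - 2" "I j ts"
    then show "map scanned ts ! 0 \<noteq> blank"
      using F[of "j + 2"] by (auto simp: I_def cells_def nat_add_distrib split: if_splits)
  next
    fix j assume j: "j < k - 2"
    show "triple (I j) (square_prog ;; go 0 Right) (9 * k * k + 45 * k + 37 + 1) (I (Suc j))"
      unfolding triple_def
    proof (intro allI impI)
      fix ts assume "I j ts"
      then obtain s b c r where ts: "ts = conf (cells k F, int j + 2) (word k s, 0)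
          (word k (lucas_lehmer_bits k j), 0) (word k b, 0) c r W"
        unfolding I_def by blast
      obtain a' b' c' where sq: "square_rounds k (lucas_lehmer_bits k j) = (a', b', c')"
        by (cases "square_rounds k (lucas_lehmer_bits k j)")
      let ?Y = "\<lambda>h. conf (cells k F, h) (word k (lucas_lehmer_bits k j), 0) (word k a', 0)
          (word k b', 0)
          (bit_symbol c') (bit_symbol (b' (k - 1))) W"
      have "leads_to ts square_prog (9 * k * k + 45 * k + 37) (?Y (int j + 2))"
        using leads_to_square[of k _ s "lucas_lehmer_bits k j"] k unfolding ts sq by simp
      moreover have "leads_to (?Y (int j + 2)) (go 0 Right) 1 (?Y (int (Suc j) + 2))"
        using leads_to_go[of 0 "?Y (int j + 2)" _ _ Right] by (simp add: algebra_simps)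
      ultimately have *: "leads_to ts (square_prog ;; go 0 Right) (9 * k * k + 45 * k + 37 + 1)
          (?Y (int (Suc j) + 2))"
        by (rule triple_Seq)
      have "I (Suc j) (?Y (int (Suc j) + 2))" unfolding I_def by (simp add: sq) blast
      then show "\<exists>t ts'. t \<le> 9 * k * k + 45 * k + 37 + 1 \<and> exec (square_prog ;; go 0 Right) ts t ts'
          \<and> I (Suc j) ts'"
        using * unfolding triple_def by blast
    qed
  next
    fix ts assume "I (k - 2) ts"
    then show "\<not> map scanned ts ! 0 \<noteq> blank"
      using k by (auto simp: I_def cells_def nat_add_distrib)
  qed
  moreover have "(k - 2) * (9 * k * k + 45 * k + 37 + 1 + 2) + 1 \<le> k * (9 * k * k + 45 * k + 40) + 1"
  proof -
    have "9 * k * k + 45 * k + 37 + 1 + 2 = 9 * k * k + 45 * k + 40" by simp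
    then show ?thesis by (simp only:) (intro add_mono mult_le_mono, simp_all)
  qed
  ultimately show ?thesis using triple_conseq by blast
qed

text \<open>The binary word of 2^k - 1 is \<open>k\<close> ones, so printing copies the unary
  counter.\<close>

definition print_prog :: prog where
  "print_prog =
     go 0 Left ;;
     While 0 (\<lambda>s. s \<noteq> blank) (Act [(0, \<lambda>ss. ss ! 0, Left), (6, \<lambda>_. bit_symbol True, Right)]) ;;
     put 6 separator Right ;; go 0 Right ;; to_end 0"

abbreviation out_tape :: "nat list \<Rightarrow> tape" where
  "out_tape w \<equiv> (written w, int (length w))"

lemma leads_to_print:
  assumes F: "\<And>i. i < k \<Longrightarrow> F i \<noteq> blank"
  shows "leads_to (conf (cells k F, int k) S A B c r (out_tape w)) print_prog (6 * k + 5)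
    (conf (cells k F, int k) S A B c r (out_tape (w @ replicate k (bit_symbol True) @ [separator])))"
proof -
  let ?w = "\<lambda>j. w @ replicate j (bit_symbol True)"
  let ?Y = "\<lambda>h w. conf (cells k F, h) S A B c r (out_tape w)"
  let ?X = "\<lambda>j. ?Y (int k - 1 - int j) (?w j)"
  have "leads_to (?Y (int k) w) (go 0 Left) 1 (?X 0)"
    using leads_to_go[of 0 "?Y (int k) w" _ _ Left] by simp
  moreover have "leads_to (?X 0)
      (While 0 (\<lambda>s. s \<noteq> blank) (Act [(0, \<lambda>ss. ss ! 0, Left), (6, \<lambda>_. bit_symbol True, Right)]))
      (k * (1 + 2) + 1) (?X k)"
  proof (rule leads_to_While[where X = ?X])
    fix j assume j: "j < k"
    then have h: "0 \<le> int k - 1 - int j" "nat (int k - 1 - int j) = k - Suc j" by auto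
    show "map scanned (?X j) ! 0 \<noteq> blank" using F[of "k - Suc j"] j h by (simp add: cells_def)
    have snoc: "(written (?w j))(int (length (?w j)) := bit_symbol True) = written (?w (Suc j))"
      unfolding written_snoc by (simp add: replicate_append_same)
    have snoc': "(written (?w j))(int (length w) + int j := bit_symbol True) = written (?w (Suc j))"
      using snoc unfolding length_append length_replicate of_nat_add .
    show "leads_to (?X j) (Act [(0, \<lambda>ss. ss ! 0, Left), (6, \<lambda>_. bit_symbol True, Right)]) 1
        (?X (Suc j))"
      by (rule leads_to_Act) (cases S; cases A; cases B; simp add: apply_updates_def updates_def
          act_eq snoc' del: replicate.simps)
  qed (simp_all add: cells_def)
  moreover have "leads_to (?X k) (put 6 separator Right) 1 (?Y (- 1) (?w k @ [separator]))"
    by (rule leads_to_eq[OF leads_to_put[of 6 "?X k" "written (?w k)" "int (length (?w k))"]])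
      (simp_all only: written_snoc, simp_all)
  moreover have "leads_to (?Y (- 1) (?w k @ [separator])) (go 0 Right) 1 (?Y 0 (?w k @ [separator]))"
    using leads_to_go[of 0 "?Y (- 1) (?w k @ [separator])" _ _ Right] by simp
  moreover have "leads_to (?Y 0 (?w k @ [separator])) (to_end 0) (3 * k + 1)
      (?Y (int k) (?w k @ [separator]))"
    using leads_to_to_end[of 0 "?Y 0 (?w k @ [separator])" k F 0] F by simp
  ultimately have "leads_to (?Y (int k) w) print_prog
      (1 + ((k * (1 + 2) + 1) + (1 + (1 + (3 * k + 1))))) (?Y (int k) (?w k @ [separator]))"
    unfolding print_prog_def by (intro triple_Seq)
  then have "leads_to (?Y (int k) w) print_prog (6 * k + 5) (?Y (int k) (?w k @ [separator]))"
    by (rule leads_to_le) simp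
  then show ?thesis by simp
qed

text \<open>Blanking the last input cell lowers the exponent by one. The work tapes are emptied
  because the next words are shorter.\<close>

definition cleanup_prog :: prog where
  "cleanup_prog = clear 1 ;; clear 2 ;; clear 3 ;; go 0 Left ;; put 0 blank Left"

text \<open>By \<open>all_lucas_lehmer_bits_iff\<close>, the scan over ones reaches the blank behind
  the word exactly when 2^k - 1 is prime.\<close>

definition test_prog :: prog where
  "test_prog =
     init_prog ;; lucas_lehmer_prog ;; While 2 (\<lambda>s. s = bit_symbol True) (go 2 Right) ;;
     When 2 (\<lambda>s. s = blank) print_prog ;;
     cleanup_prog"

lemma triple_all_ones:
  fixes U S B W :: tape and c r k :: nat and a :: "nat \<Rightarrow> bool"
  defines "Y \<equiv> \<lambda>h. conf U S (word k a, int h) B c r W"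
  shows "triple (\<lambda>ts. ts = Y 0) (While 2 (\<lambda>s. s = bit_symbol True) (go 2 Right)) (3 * k + 1)
    (\<lambda>ts. \<exists>h\<le>k. ts = Y h \<and> (h = k \<longleftrightarrow> (\<forall>i<k. a i)))"
proof -
  obtain m where m: "m \<le> k" "\<And>i. i < m \<Longrightarrow> a i" "m < k \<Longrightarrow> \<not> a m" "m = k \<longleftrightarrow> (\<forall>i<k. a i)"
  proof (cases "\<forall>i<k. a i")
    case True
    then show ?thesis using that[of k] by simp
  next
    case False
    then obtain m where "m < k \<and> \<not> a m" "\<And>i. i < m \<Longrightarrow> \<not> (i < k \<and> \<not> a i)"
      using exists_least_iff[of "\<lambda>i. i < k \<and> \<not> a i"] by blast
    then show ?thesis using that[of m] by force
  qed
  have "leads_to (Y 0) (While 2 (\<lambda>s. s = bit_symbol True) (go 2 Right)) (m * (1 + 2) + 1) (Y m)"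
  proof (rule leads_to_While[where X = Y])
    fix j assume j: "j < m"
    then show "map scanned (Y j) ! 2 = bit_symbol True" using m(1,2) by (simp add: Y_def cells_def)
    show "leads_to (Y j) (go 2 Right) 1 (Y (Suc j))"
      using leads_to_go[of 2 "Y j" _ _ Right] by (simp add: Y_def algebra_simps)
  qed (use m(3) in \<open>auto simp: Y_def cells_def bit_symbol_def blank_def\<close>)
  then show ?thesis by (rule triple_conseq) (use m in auto)
qed

lemma triple_test:
  fixes F :: "nat \<Rightarrow> nat" and w :: "nat list"
  assumes k: "k \<ge> 3" and F: "\<And>i. i < k \<Longrightarrow> F i \<noteq> blank"
  defines "I \<equiv> \<lambda>k w ts. \<exists>c r. ts = conf (cells k F, int k - 1) empty_tape empty_tape empty_tape c r
      (out_tape w)"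
  shows "triple (I k w) test_prog (100 * (k + 1) ^ 3)
    (I (k - 1) (if prime (2 ^ k - 1 :: nat) then w @ replicate k (bit_symbol True) @ [separator]
        else w))"
proof -
  let ?w' = "if prime (2 ^ k - 1 :: nat) then w @ replicate k (bit_symbol True) @ [separator] else w"
  define P where "P j ts \<longleftrightarrow> (\<exists>s b c r. ts = conf (cells k F, int (j + 2)) (word k s, 0)
      (word k (lucas_lehmer_bits k j), 0) (word k b, 0) c r (out_tape w))" for j ts
  \<comment> \<open>The flag \<open>hk\<close> says that the head position still encodes primality.
    After printing, \<open>clear\<close> needs only \<open>h \<le> k\<close>.\<close>
  define Q where "Q v hk ts \<longleftrightarrow> (\<exists>s a b c r h. h \<le> k \<and> (hk \<longrightarrow> (h = k \<longleftrightarrow> prime (2 ^ k - 1 :: nat))) \<and>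
      ts = conf (cells k F, int k) (word k s, 0) (word k a, int h) (word k b, 0) c r (out_tape v))"
          for v hk ts
  have "triple (I k w) init_prog (12 * k + 17) (P 0)"
    unfolding triple_def
  proof (intro allI impI)
    fix ts assume "I k w ts"
    then obtain c r where ts: "ts = conf (cells k F, int k - 1) empty_tape empty_tape empty_tape c r
        (out_tape w)"
      unfolding I_def by blast
    have "P 0 (conf (cells k F, 2) (word k (\<lambda>_. False), 0) (word k (\<lambda>i. i = 2), 0)
        (word k (\<lambda>_. False), 0) c r (out_tape w))"
      unfolding P_def by auto
    then show "\<exists>t ts'. t \<le> 12 * k + 17 \<and> exec init_prog ts t ts' \<and> P 0 ts'"
      using leads_to_init[of k F c r "out_tape w"] k F unfolding triple_def ts by blast
  qed
  moreover have "triple (P 0) lucas_lehmer_prog (k * (9 * k * k + 45 * k + 40) + 1) (P (k - 2))"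
    using triple_lucas_lehmer[of k F "out_tape w"] k F unfolding P_def by simp
  moreover have "triple (P (k - 2)) (While 2 (\<lambda>s. s = bit_symbol True) (go 2 Right)) (3 * k + 1)
      (Q w True)"
    unfolding triple_def
  proof (intro allI impI)
    fix ts assume "P (k - 2) ts"
    then obtain s b c r where ts: "ts = conf (cells k F, int k) (word k s, 0)
      (word k (lucas_lehmer_bits k (k - 2)), 0) (word k b, 0) c r (out_tape w)"
      unfolding P_def using k by auto
    obtain t ts' h where "t \<le> 3 * k + 1" "exec (While 2 (\<lambda>s. s = bit_symbol True) (go 2 Right)) ts t
        ts'"
      "h \<le> k" "ts' = conf (cells k F, int k) (word k s, 0)
      (word k (lucas_lehmer_bits k (k - 2)), int h) (word k b, 0) c r (out_tape w)"
      "h = k \<longleftrightarrow> (\<forall>i<k. lucas_lehmer_bits k (k - 2) i)"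
      using triple_all_ones[of "(cells k F, int k)" "(word k s, 0)" k "lucas_lehmer_bits k (k - 2)"
          "(word k b, 0)" c r "out_tape w"]
      unfolding triple_def ts by auto
    then show "\<exists>t ts'. t \<le> 3 * k + 1 \<and> exec (While 2 (\<lambda>s. s = bit_symbol True) (go 2 Right)) ts t
        ts' \<and> Q w True ts'"
      unfolding Q_def all_lucas_lehmer_bits_iff[OF k] by blast
  qed
  moreover have "triple (Q w True) (When 2 (\<lambda>s. s = blank) print_prog) (6 * k + 6) (Q ?w' False)"
    unfolding triple_def
  proof (intro allI impI)
    fix ts assume "Q w True ts"
    then obtain s a b c r h where h: "h \<le> k" "h = k \<longleftrightarrow> prime (2 ^ k - 1 :: nat)" and
      ts: "ts = conf (cells k F, int k) (word k s, 0) (word k a, int h) (word k b, 0) c r (out_tape w)"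
      unfolding Q_def by blast
    let ?ts' = "conf (cells k F, int k) (word k s, 0) (word k a, int h) (word k b, 0) c r
        (out_tape ?w')"
    have "leads_to ts (When 2 (\<lambda>s. s = blank) print_prog) (6 * k + 6) ?ts'"
    proof (cases "h = k")
      case True
      have "leads_to ts print_prog (6 * k + 5) ?ts'"
        using leads_to_print[of k F] F h True unfolding ts by simp
      then have "leads_to ts (When 2 (\<lambda>s. s = blank) print_prog) (6 * k + 5 + 1) ?ts'"
        by (rule leads_to_When_True[rotated]) (simp add: ts True cells_def)
      then show ?thesis by (rule leads_to_le) simp
    next
      case False
      then have "leads_to ts (When 2 (\<lambda>s. s = blank) print_prog) 1 ts"
        using h(1) by (intro leads_to_When_False) (simp add: ts cells_def)
      moreover have "ts = ?ts'" using False h by (simp add: ts)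
      ultimately show ?thesis using leads_to_le[of ts _ 1 ts "6 * k + 6"] by simp
    qed
    moreover have "Q ?w' False ?ts'" using h(1) unfolding Q_def by blast
    ultimately show "\<exists>t ts'. t \<le> 6 * k + 6 \<and> exec (When 2 (\<lambda>s. s = blank) print_prog) ts t ts' \<and> Q
        ?w' False ts'"
      unfolding triple_def by blast
  qed
  moreover have "triple (Q v False) cleanup_prog (18 * k + 14) (I (k - 1) v)" for v
    unfolding triple_def
  proof (intro allI impI)
    fix ts assume "Q v False ts"
    then obtain s a b c r h where h: "h \<le> k" and
      ts: "ts = conf (cells k F, int k) (word k s, 0) (word k a, int h) (word k b, 0) c r (out_tape v)"
      unfolding Q_def by blast
    let ?Y = "\<lambda>U S A B. conf U S A B c r (out_tape v)"
    let ?U = "(cells k F, int k)"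
    have "leads_to ts (clear 1) (6 * k + 4) (?Y ?U empty_tape (word k a, int h) (word k b, 0))"
      using leads_to_clear[of 1 ts k _ 0] by (simp add: ts)
    moreover have "leads_to (?Y ?U empty_tape (word k a, int h) (word k b, 0)) (clear 2) (6 * k + 4)
        (?Y ?U empty_tape empty_tape (word k b, 0))"
      using leads_to_clear[of 2 "?Y ?U empty_tape (word k a, int h) (word k b, 0)" k _ h] h by simp
    moreover have "leads_to (?Y ?U empty_tape empty_tape (word k b, 0)) (clear 3) (6 * k + 4)
        (?Y ?U empty_tape empty_tape empty_tape)"
      using leads_to_clear[of 3 "?Y ?U empty_tape empty_tape (word k b, 0)" k _ 0] by simp
    moreover have "leads_to (?Y ?U empty_tape empty_tape empty_tape) (go 0 Left) 1
        (?Y (cells k F, int (k - 1)) empty_tape empty_tape empty_tape)"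
      using leads_to_go[of 0 "?Y ?U empty_tape empty_tape empty_tape" _ _ Left] k
          by (simp add: of_nat_diff)
    moreover have "leads_to (?Y (cells k F, int (k - 1)) empty_tape empty_tape empty_tape)
        (put 0 blank Left) 1
        (?Y (cells (k - 1) F, int (k - 1) - 1) empty_tape empty_tape empty_tape)"
      by (rule leads_to_eq[OF leads_to_put]) (use k cells_butlast[of "k - 1" F] in auto)
    ultimately have "leads_to ts cleanup_prog
        ((6 * k + 4) + ((6 * k + 4) + ((6 * k + 4) + (1 + 1))))
        (?Y (cells (k - 1) F, int (k - 1) - 1) empty_tape empty_tape empty_tape)"
      unfolding cleanup_prog_def by (intro triple_Seq)
    then have "leads_to ts cleanup_prog (18 * k + 14)
        (?Y (cells (k - 1) F, int (k - 1) - 1) empty_tape empty_tape empty_tape)"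
      by (rule leads_to_le) simp
    then show "\<exists>t ts'. t \<le> 18 * k + 14 \<and>
        exec cleanup_prog ts t ts' \<and> I (k - 1) v ts'"
      unfolding triple_def I_def by blast
  qed
  ultimately have "triple (I k w) test_prog
      ((12 * k + 17) + ((k * (9 * k * k + 45 * k + 40) + 1) +
          ((3 * k + 1) + ((6 * k + 6) + (18 * k + 14)))))
      (I (k - 1) ?w')"
    unfolding test_prog_def by (intro triple_Seq)
  \<comment> \<open>The sum is 9k^3 + 45k^2 + 79k + 39, dominated coefficientwise by the generous
    cubic bound.\<close>
  then show ?thesis
    by (rule triple_conseq) (simp_all add: algebra_simps power3_eq_cube)
qed

text \<open>The numbers printed in the first \<open>j\<close> iterations of the main loop; exponents
  descend from \<open>n\<close> because the input shrinks.\<close>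

definition mersenne_list :: "nat \<Rightarrow> nat \<Rightarrow> nat list" where
  "mersenne_list n j =
     map (\<lambda>k. 2 ^ k - 1) (filter (\<lambda>k. prime (2 ^ k - 1 :: nat)) (map (\<lambda>i. n - i) [0..<j]))"

lemma list_output_mersenne_list_Suc:
  "list_output (mersenne_list n (Suc j)) =
     (if prime (2 ^ (n - j) - 1 :: nat)
      then list_output (mersenne_list n j) @ replicate (n - j) (bit_symbol True) @ [separator]
      else list_output (mersenne_list n j))"
proof -
  have "map bit_symbol (binary (2 ^ (n - j) - 1)) = replicate (n - j) (bit_symbol True)"
    by (simp only: binary_mersenne map_replicate)
  then show ?thesis by (simp add: mersenne_list_def list_output_def)
qed

lemma set_mersenne_list:
  "set (mersenne_list n (n - N)) = {p. mersenne_prime p \<and> N < bin_length p \<and> bin_length p \<le> n}"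
  (is "?A = ?B")
proof
  show "?A \<subseteq> ?B"
  proof
    fix p assume "p \<in> ?A"
    then obtain i where "i < n - N" "p = 2 ^ (n - i) - 1" "prime p"
      by (auto simp: mersenne_list_def)
    then show "p \<in> ?B" using bin_length_mersenne[of "n - i"] by (auto simp: mersenne_prime_def)
  qed
  show "?B \<subseteq> ?A"
  proof
    fix p assume p: "p \<in> ?B"
    then obtain k where k: "p = 2 ^ k - 1" by (auto simp: mersenne_prime_def)
    then have "N < k" "k \<le> n" "prime p" using p bin_length_mersenne[of k]
        by (auto simp: mersenne_prime_def)
    then have "k = n - (n - k)" "n - k < n - N" by auto
    then show "p \<in> ?A" using k \<open>prime p\<close> by (force simp: mersenne_list_def)
  qed
qed

lemma distinct_mersenne_list: "j \<le> n \<Longrightarrow> distinct (mersenne_list n j)"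
  unfolding mersenne_list_def distinct_map
proof (intro conjI distinct_filter)
  show "distinct (map (\<lambda>i. n - i) [0..<j])" if "j \<le> n"
    using that by (auto simp: distinct_map inj_on_def)
  show "inj_on (\<lambda>k. 2 ^ k - 1 :: nat) A" for A
    by (rule inj_onI) (metis bin_length_mersenne)
qed

text \<open>\<open>N\<close> is fixed for the machine, so marking is unrolled into \<open>N\<close>
  steps. Blanks stay blank, so a shorter input keeps its length.\<close>

primrec mark_prefix :: "nat \<Rightarrow> prog \<Rightarrow> prog" where
  "mark_prefix 0 p = p"
| "mark_prefix (Suc N) p =
     Act [(0, \<lambda>ss. if ss ! 0 = blank then blank else separator, Right)] ;; mark_prefix N p"

text \<open>The mark on the first \<open>N\<close> input cells stops the main loop once the exponent is down to \<open>N\<close>.\<close>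

definition main_prog :: "nat \<Rightarrow> prog" where
  "main_prog N =
     mark_prefix N (to_end 0 ;; go 0 Left ;; While 0 (\<lambda>s. s \<noteq> blank \<and> s \<noteq> separator) test_prog)"

lemma symbol_neq [simp]: "separator \<noteq> blank" "bit_symbol b \<noteq> separator" "separator < 4"
  by (auto simp: separator_def blank_def bit_symbol_def)

lemma triple_mark_prefix:
  fixes F :: "nat \<Rightarrow> nat" and n :: nat
  defines "X \<equiv> \<lambda>h. conf (cells n (\<lambda>i. if i < h then separator else F i), int h)
     empty_tape empty_tape empty_tape blank blank (out_tape [])"
  assumes F: "\<And>i. i < n \<Longrightarrow> F i \<noteq> blank"
    and p: "triple (\<lambda>ts. ts = X (h + N)) p b Q"
  shows "triple (\<lambda>ts. ts = X h) (mark_prefix N p) (N + b) Q"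
  using p
proof (induction N arbitrary: h)
  case (Suc N)
  have "(cells n (\<lambda>i. if i < h then separator else F i))
      (int h := if cells n (\<lambda>i. if i < h then separator else F i) (int h) = blank then blank else
          separator) =
      cells n (\<lambda>i. if i < Suc h then separator else F i)"
    using F by (auto simp: fun_eq_iff cells_def)
  then have "leads_to (X h) (Act [(0, \<lambda>ss. if ss ! 0 = blank then blank else separator, Right)]) 1
      (X (Suc h))"
    by (intro leads_to_Act) (simp add: X_def apply_update act_eq)
  moreover have "triple (\<lambda>ts. ts = X (Suc h)) (mark_prefix N p) (N + b) Q"
    using Suc by simp
  ultimately have "triple (\<lambda>ts. ts = X h) (mark_prefix (Suc N) p) (1 + (N + b)) Q"
    unfolding mark_prefix.simps by (rule triple_Seq)
  then show ?case by simp
qed simp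

lemma triple_main:
  fixes x :: "bool list" and N :: nat
  defines "n \<equiv> length x"
  assumes N: "N \<ge> 2"
  shows "triple (\<lambda>ts. ts = snd (initial_config (machine 7 (main_prog N)) x)) (main_prog N)
    (N + (3 * n + 3 + n * (100 * (n + 1) ^ 3 + 2)))
    (\<lambda>ts. last ts = out_tape (list_output (mersenne_list n (n - N))))"
proof -
  define F where "F i = (if i < N then separator else bit_symbol (x ! i))" for i
  have F: "F i \<noteq> blank" for i by (simp add: F_def)
  define loop where "loop = While 0 (\<lambda>s. s \<noteq> blank \<and> s \<noteq> separator) test_prog"
  let ?E = "empty_tape"
  let ?Y = "\<lambda>h. conf (cells n F, h) ?E ?E ?E blank blank (out_tape [])"
  let ?Q = "\<lambda>ts. last ts = out_tape (list_output (mersenne_list n (n - N)))"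
  have init: "snd (initial_config (machine 7 (main_prog N)) x) =
      conf (cells n (\<lambda>i. if i < 0 then separator else bit_symbol (x ! i)), int 0) ?E ?E ?E blank
          blank (out_tape [])"
  proof -
    have "written (map bit_symbol x) = cells n (\<lambda>i. bit_symbol (x ! i))"
      unfolding written_eq_cells by (auto simp: n_def intro!: cells_cong)
    moreover have "written [] = (\<lambda>_. blank)" "cells 0 (\<lambda>_. blank) = (\<lambda>_. blank)"
      by (auto simp: fun_eq_iff written_def cells_def)
    moreover have "(\<lambda>_. blank)(0 := blank) = (\<lambda>_ :: int. blank)" by auto
    ultimately show ?thesis by (simp add: initial_config_def machine_def eval_nat_numeral)
  qed
  have "triple (\<lambda>ts. ts = ?Y (int N)) (to_end 0 ;; go 0 Left ;; loop)
      (3 * n + 3 + n * (100 * (n + 1) ^ 3 + 2)) ?Q"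
  proof (cases "N \<le> n")
    case True
    define I where "I j ts \<longleftrightarrow> (\<exists>c r. ts = conf (cells (n - j) F, int (n - j) - 1) ?E ?E ?E c r
      (out_tape (list_output (mersenne_list n j))))" for j ts
    have "leads_to (?Y (int N)) (to_end 0) (3 * n + 1) (?Y (int n))"
      using leads_to_to_end[of 0 "?Y (int N)" n F N] True F by simp
    moreover have "leads_to (?Y (int n)) (go 0 Left) 1 (?Y (int n - 1))"
      using leads_to_go[of 0 "?Y (int n)" _ _ Left] by simp
    moreover have "triple (I 0) loop ((n - N) * (100 * (n + 1) ^ 3 + 2) + 1) (I (n - N))"
      unfolding loop_def
    proof (rule triple_While)
      fix j ts assume j: "j < n - N" and ts: "I j ts"
      have "nat (int (n - j) - 1) = n - Suc j" "0 \<le> int (n - j) - 1" "n - Suc j < n - j" using j by auto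
      then have "cells (n - j) F (int (n - j) - 1) = F (n - Suc j)"
        using j by (simp add: cells_def del: of_nat_diff)
      moreover have "\<not> n - Suc j < N" using j by linarith
      then have "F (n - Suc j) = bit_symbol (x ! (n - Suc j))" by (simp add: F_def)
      ultimately have "cells (n - j) F (int (n - j) - 1) = bit_symbol (x ! (n - Suc j))" by (rule trans)
      then show "map scanned ts ! 0 \<noteq> blank \<and> map scanned ts ! 0 \<noteq> separator"
        using ts by (auto simp: I_def simp del: of_nat_diff)
    next
      fix j assume j: "j < n - N"
      \<comment> \<open>Every tested exponent exceeds \<open>N \<ge> 2\<close>, as the Lucas--Lehmer
        test demands.\<close>
      then have k: "3 \<le> n - j" using N by linarith
      have "triple (I j) test_prog (100 * (n - j + 1) ^ 3) (I (Suc j))"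
        using triple_test[OF k F, where w = "list_output (mersenne_list n j)"]
        unfolding I_def list_output_mersenne_list_Suc
        by (simp only: diff_Suc_eq_diff_pred diff_commute diff_diff_left)
      moreover have "100 * (n - j + 1) ^ 3 \<le> 100 * (n + 1) ^ 3"
        by (intro mult_le_mono power_mono) auto
      ultimately show "triple (I j) test_prog (100 * (n + 1) ^ 3) (I (Suc j))"
        using triple_conseq by blast
    next
      fix ts assume ts: "I (n - N) ts"
      have "n - (n - N) = N" using True by simp
      moreover have "cells N F (int N - 1) = separator"
      proof -
        have "nat (int N - 1) = N - 1" "0 \<le> int N - 1" "N - 1 < N" using N by auto
        then show ?thesis by (simp add: cells_def F_def)
      qed
      ultimately show "\<not> (map scanned ts ! 0 \<noteq> blank \<and> map scanned ts ! 0 \<noteq> separator)"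
        using ts by (auto simp: I_def)
    qed
    then have "triple (\<lambda>ts. ts = ?Y (int n - 1)) loop ((n - N) * (100 * (n + 1) ^ 3 + 2) + 1) ?Q"
    proof (rule triple_conseq)
      show "I 0 ts" if "ts = ?Y (int n - 1)" for ts
        using that unfolding I_def by (auto simp: mersenne_list_def list_output_def)
    qed (auto simp: I_def)
    ultimately have "triple (\<lambda>ts. ts = ?Y (int N)) (to_end 0 ;; go 0 Left ;; loop)
        (3 * n + 1 + (1 + ((n - N) * (100 * (n + 1) ^ 3 + 2) + 1))) ?Q"
      by (intro triple_Seq)
    then show ?thesis
    proof (rule triple_conseq)
      have "(n - N) * (100 * (n + 1) ^ 3 + 2) \<le> n * (100 * (n + 1) ^ 3 + 2)"
        by (intro mult_le_mono) auto
      then show "3 * n + 1 + (1 + ((n - N) * (100 * (n + 1) ^ 3 + 2) + 1)) \<le> 3 * n + 3 + n *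
          (100 * (n + 1) ^ 3 + 2)"
        by linarith
    qed
  next
    case False
    \<comment> \<open>The marking ran beyond the input: cells \<open>N\<close> and
      \<open>N - 1\<close> are both blank, so neither loop is entered and nothing is
      printed.\<close>
    have "leads_to (?Y (int N)) (to_end 0) (0 * (1 + 2) + 1) (?Y (int N))"
      unfolding to_end_def
      by (rule leads_to_While[where X = "\<lambda>_. ?Y (int N)"]) (use False in \<open>auto simp: cells_def\<close>)
    moreover have "leads_to (?Y (int N)) (go 0 Left) 1 (?Y (int N - 1))"
      using leads_to_go[of 0 "?Y (int N)" _ _ Left] by simp
    moreover have "leads_to (?Y (int N - 1)) loop (0 * (0 + 2) + 1) (?Y (int N - 1))"
      unfolding loop_def
      by (rule leads_to_While[where X = "\<lambda>_. ?Y (int N - 1)"]) (use False in \<open>auto simp: cells_def\<close>)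
    ultimately have "leads_to (?Y (int N)) (to_end 0 ;; go 0 Left ;; loop)
        (0 * (1 + 2) + 1 + (1 + (0 * (0 + 2) + 1))) (?Y (int N - 1))"
      by (intro triple_Seq)
    then show ?thesis
      by (rule triple_conseq) (use False in \<open>auto simp: mersenne_list_def list_output_def\<close>)
  qed
  then have "triple (\<lambda>ts. ts = conf (cells n (\<lambda>i. if i < 0 then separator else bit_symbol (x ! i)),
      int 0)
      ?E ?E ?E blank blank (out_tape [])) (mark_prefix N (to_end 0 ;; go 0 Left ;; loop))
      (N + (3 * n + 3 + n * (100 * (n + 1) ^ 3 + 2))) ?Q"
    by (intro triple_mark_prefix) (simp_all add: F_def[abs_def])
  then show ?thesis unfolding main_prog_def init[unfolded main_prog_def] loop_def .
qed

lemma wf_main_prog: "wf_prog 7 (main_prog N)"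
proof -
  have nth: "ss ! i < 4" if "length ss = 7" "set ss \<subseteq> {..<4}" "i < 7" for ss :: "nat list" and i
    using that by (metis nth_mem lessThan_iff subsetD)
  have "wf_prog 7 test_prog"
    by (simp add: test_prog_def init_prog_def lucas_lehmer_prog_def square_prog_def transfer_def
        mult_round_prog_def add_pass_def add_step_def reload_def print_prog_def cleanup_prog_def
        clear_def to_start_def to_end_def go_def put_def nth)
  moreover have "wf_prog 7 p \<Longrightarrow> wf_prog 7 (mark_prefix M p)" for M p
    by (induction M) simp_all
  ultimately show ?thesis by (simp add: main_prog_def to_end_def go_def nth)
qed

lemma P_printable_mersenne_primes:
  assumes "N \<ge> 2"
  shows "P_printable {p. mersenne_prime p \<and> N < bin_length p}"
proof -
  define M where "M = machine 7 (main_prog N)"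
  define q :: "nat poly" where
    "q = [:N:] + ([:3:] * [:0, 1:] + [:3:] + [:0, 1:] * ([:100:] * ([:0, 1:] + 1) ^ 3 + [:2:]))"
  have q: "poly q n = N + (3 * n + 3 + n * (100 * (n + 1) ^ 3 + 2))" for n
    by (simp add: q_def algebra_simps)
  have run: "\<exists>t ts. t \<le> poly q (length x) \<and> run M x t = (halt_state M, ts) \<and>
      last ts = out_tape (list_output (mersenne_list (length x) (length x - N)))" for x
  proof -
    obtain t ts where "t \<le> poly q (length x)" "exec (main_prog N) (snd (initial_config M x)) t ts"
      "last ts = out_tape (list_output (mersenne_list (length x) (length x - N)))"
      using triple_main[OF assms, of x] unfolding triple_def q M_def by blast
    moreover have "halt_state M = code_size (main_prog N)" by (simp add: M_def machine_def)
    ultimately show ?thesis using exec_machine unfolding M_def by metis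
  qed
  have "wf_turing_machine M" unfolding M_def by (intro wf_machine wf_main_prog) simp
  moreover have "polynomial_time M"
    unfolding polynomial_time_def
  proof (intro exI allI)
    fix x
    obtain t ts where t: "t \<le> poly q (length x)" "run M x t = (halt_state M, ts)" using run by blast
    then show "halted M (run M x (poly q (length x)))"
      using run_halted[of M x t] by (simp add: halted_def)
  qed
  moreover have "\<exists>ms. distinct ms \<and> set ms = {p \<in> {p. mersenne_prime p \<and> N < bin_length p}.
      bin_length p \<le> n} \<and>
      prints M (replicate n True) (list_output ms)" for n
  proof (intro exI conjI)
    show "distinct (mersenne_list n (n - N))" by (rule distinct_mersenne_list) simp
    show "set (mersenne_list n (n - N)) = {p \<in> {p. mersenne_prime p \<and> N < bin_length p}. bin_length
        p \<le> n}"
      unfolding set_mersenne_list by auto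
    show "prints M (replicate n True) (list_output (mersenne_list n (n - N)))"
    proof -
      obtain t ts where "run M (replicate n True) t = (halt_state M, ts)"
        "last ts = out_tape (list_output (mersenne_list n (n - N)))"
        using run[of "replicate n True"] by auto
      then show ?thesis unfolding prints_def halted_def by (intro exI[of _ t]) simp
    qed
  qed
  ultimately show ?thesis unfolding P_printable_def by blast
qed

theorem theorem4p14:
  assumes "Lenstra_Pomerance_Wagstaff"
  shows "\<forall>\<epsilon>::real. \<epsilon> > 0 \<longrightarrow>
    (\<exists>S \<subseteq> {p. mersenne_prime p}. nongappy (\<lambda>t. t powr (1 + \<epsilon>)) S \<and> P_printable S) \<and>
    (\<exists>S \<subseteq> {p::nat. prime p}. nongappy (\<lambda>t. t powr (1 + \<epsilon>)) S \<and> P_printable S)"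
proof (intro allI impI)
  fix \<epsilon> :: real assume "\<epsilon> > 0"
  then obtain N0 where N0: "\<And>N. N \<ge> N0 \<Longrightarrow>
      nongappy (\<lambda>t. t powr (1 + \<epsilon>)) {p. mersenne_prime p \<and> N < bin_length p}"
    using LPW_nongappy_mersenne_primes[OF assms] by blast
  \<comment> \<open>The bound \<open>N0\<close> is for the gaps, 2 for the primality test. The same
    set serves both claims.\<close>
  let ?S = "{p. mersenne_prime p \<and> max 2 N0 < bin_length p}"
  have "nongappy (\<lambda>t. t powr (1 + \<epsilon>)) ?S" "P_printable ?S"
    by (rule N0 P_printable_mersenne_primes; simp)+
  moreover have "?S \<subseteq> {p. mersenne_prime p}" "?S \<subseteq> {p. prime p}"
    by (auto simp: mersenne_prime_def)
  ultimately show "(\<exists>S \<subseteq> {p. mersenne_prime p}. nongappy (\<lambda>t. t powr (1 + \<epsilon>)) S \<and> P_printable S) \<and>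
    (\<exists>S \<subseteq> {p::nat. prime p}. nongappy (\<lambda>t. t powr (1 + \<epsilon>)) S \<and> P_printable S)"
    by blast
qed

end
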